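(* Let $\mathcal P$ be a compressed labeled oriented tree (LOT) and $\mathcal T$ a maximal proper sub-LOT of $\mathcal P$ with vertex set $S$. Let $\bar{\mathcal P}$ be the LOT obtained from $\mathcal P$ by collapsing all of $\mathcal T$ to a vertex $y$ and replacing every occurrence of a vertex $x$ of $\mathcal T$ in $\mathcal P-\mathcal T$ (including as an edge label) by $y$. Let $T$, $P$, $\bar P$ be the LOT presentations corresponding to $\mathcal T,\mathcal P,\bar{\mathcal P}$. If $\bar P$ is compressed and DR directed away from $\{y\}$, then $P$ is DR directed away from $S$, the set of generators of $T$. In particular, if $\bar P$ is compressed and (1) $W^+(\bar P)$ or $W^-(\bar P)$ is a tree, or (2) the Whitehead graph $W(\bar P)$ does not contain cycles of length less than four, then $P$ is DR directed away from $S$.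
   Context: A labeled oriented tree (LOT) $\mathcal P$ is a finite oriented graph which is a tree and whose oriented edges are labeled by its vertices. Its LOT presentation $P$ has the vertices of $\mathcal P$ as generators and, for every oriented edge from a vertex $u_1$ to a vertex $u_2$ labeled by $u_3$, the relator $u_1u_3(u_3u_2)^{-1}$. A sub-LOT of $\mathcal P$ is a connected subgraph $\mathcal T$ (containing at least one edge) such that each edge label of $\mathcal T$ is a vertex of $\mathcal T$. A LOT (or its presentation) is compressed if each relator consists of three different generators. For a finite presentation $Q$, $K(Q)$ is the 2-complex with one vertex, one oriented edge for each generator, and one 2-cell for each relator, attached along the relator word. The Whitehead graph $W(Q)$ is the boundary of a regular neighborhood of the only vertex of $K(Q)$: a non-oriented (multi)graph with two vertices $a^+,a^-$ (near the beginning, respectively the ending, of the oriented edge $a$) for each generator $a$, and one edge for each pair of cyclically consecutive letters $a^{\epsilon}b^{\delta}$ of a relator, joining $a^{-}$ (if $\epsilon=1$) or $a^+$ (if $\epsilon=-1$) to $b^+$ (if $\delta=1$) or $b^-$ (if $\delta=-1$). $W^+(Q)$, $W^-(Q)$ are the full subgraphs on the vertices $a^+$, respectively $a^-$. A cycle is a closed edge path; in (2) cycles are understood to be reduced (no cyclically consecutive pair $ee^{-1}$). A spherical diagram over $K(Q)$ is a map $f\colon C\to K(Q)$, with $C$ a 2-sphere with cell structure, that maps open cells homeomorphically to open cells; the label of an edge of $C$ is the generator it maps to. A folding edge of $C$ is an edge $e$ such that the two 2-cells of $C$ containing $e$ in their boundary map to the same 2-cell of $K(Q)$ with opposite orientations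 by folding over $e$ (mirror images across $e$, so $e$ corresponds to the same letter position of the relator in both). For a proper subset $S$ of the generators, $Q$ is DR directed away from $S$ if every spherical diagram that contains an edge with label not from $S$ also contains a folding edge with label not from $S$. *)

theory Defs
  imports "Graph_Theory.Graph_Theory" "HOL-Combinatorics.Orbits"
begin

section \<open>Undirected edge paths in multigraphs\<close>

text \<open>
  A non-oriented multigraph is represented by a \<^typ>\<open>('v, 'e) pre_digraph\<close> whose arcs may be
  traversed in both directions: \<open>(e, True)\<close> is \<open>e\<close> traversed from tail to head, \<open>(e, False)\<close> is its
  inverse. The constants \<open>cycle\<close>, \<open>forest\<close> and \<open>tree\<close> of the library only see paths that
  follow the orientation of the arcs and are therefore not usable here; its \<open>connected\<close>
  is connectedness of the underlying non-oriented graph, and includes non-emptiness.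
\<close>

type_synonym 'e oedge = "'e \<times> bool"

definition ostart :: "('v, 'e) pre_digraph \<Rightarrow> 'e oedge \<Rightarrow> 'v" where
  "ostart G x = (if snd x then tail G (fst x) else head G (fst x))"

definition oend :: "('v, 'e) pre_digraph \<Rightarrow> 'e oedge \<Rightarrow> 'v" where
  "oend G x = (if snd x then head G (fst x) else tail G (fst x))"

definition oinv :: "'e oedge \<Rightarrow> 'e oedge" where
  "oinv x = (fst x, \<not> snd x)"

definition closed_edge_path :: "('v, 'e) pre_digraph \<Rightarrow> 'e oedge list \<Rightarrow> bool" where
  "closed_edge_path G p \<longleftrightarrow> p \<noteq> [] \<and> fst ` set p \<subseteq> arcs G \<and>
     (\<forall>i < length p. oend G (p ! i) = ostart G (p ! (Suc i mod length p)))"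

definition reduced_cycle :: "('v, 'e) pre_digraph \<Rightarrow> 'e oedge list \<Rightarrow> bool" where
  "reduced_cycle G p \<longleftrightarrow> closed_edge_path G p \<and>
     (\<forall>i < length p. p ! (Suc i mod length p) \<noteq> oinv (p ! i))"

definition undirected_tree :: "('v, 'e) pre_digraph \<Rightarrow> bool" where
  "undirected_tree G \<longleftrightarrow> connected G \<and> (\<nexists>p. reduced_cycle G p)"


section \<open>Presentations and Whitehead graphs\<close>

text \<open>
  A letter \<open>(a, True)\<close> stands for \<open>a\<close>, a letter \<open>(a, False)\<close> for the inverse of \<open>a\<close>.
  Relators are indexed, so that the 2-cells of the 2-complex \<open>K(Q)\<close> of a presentation \<open>Q\<close>
  are the elements of \<open>rels Q\<close>.
\<close>

type_synonym 'g letter = "'g \<times> bool"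

record ('g, 'r) presentation =
  gens :: "'g set"
  rels :: "'r set"
  relator :: "'r \<Rightarrow> 'g letter list"

definition compressed :: "('g, 'r) presentation \<Rightarrow> bool" where
  "compressed Q \<longleftrightarrow> (\<forall>r \<in> rels Q. card (fst ` set (relator Q r)) = 3)"

text \<open>
  The vertex \<open>a\<^sup>+\<close> is \<open>(a, True)\<close>, the vertex \<open>a\<^sup>-\<close> is \<open>(a, False)\<close>. The edge \<open>(r, i)\<close> is the corner
  between the letters \<open>i\<close> and \<open>i + 1\<close> (cyclically) of \<open>r\<close>; which of its two ends is called
  tail and which head is immaterial.
\<close>

definition whitehead_graph ::
    "('g, 'r) presentation \<Rightarrow> ('g \<times> bool, 'r \<times> nat) pre_digraph" where
  "whitehead_graph Q =
    \<lparr> verts = gens Q \<times> UNIV,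
      arcs = {(r, i). r \<in> rels Q \<and> i < length (relator Q r)},
      tail = (\<lambda>(r, i). case relator Q r ! i of (a, \<epsilon>) \<Rightarrow> (a, \<not> \<epsilon>)),
      head = (\<lambda>(r, i). relator Q r ! (Suc i mod length (relator Q r))) \<rparr>"

definition whitehead_plus ::
    "('g, 'r) presentation \<Rightarrow> ('g \<times> bool, 'r \<times> nat) pre_digraph" where
  "whitehead_plus Q = whitehead_graph Q \<restriction> (gens Q \<times> {True})"

definition whitehead_minus ::
    "('g, 'r) presentation \<Rightarrow> ('g \<times> bool, 'r \<times> nat) pre_digraph" where
  "whitehead_minus Q = whitehead_graph Q \<restriction> (gens Q \<times> {False})"


section \<open>Spherical diagrams and directed diagrammatic reducibility\<close>

text \<open>
  A cell structure on the oriented 2-sphere (with at least one edge) is given by its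
  combinatorial map. The darts are the oriented edges; \<open>opp\<close> reverses a dart; \<open>nxt d\<close> is the
  dart that follows \<open>d\<close> on the boundary of the 2-cell to the left of \<open>d\<close>. Hence 2-cells are the
  orbits of \<open>nxt\<close>, edges the pairs \<open>{d, opp d}\<close>, and vertices the orbits of \<open>nxt \<circ> opp\<close>, which
  consist of the darts with a common start. The surface is a sphere iff
  it is connected and has Euler characteristic 2.

  A map to \<open>K(Q)\<close> that is a homeomorphism on open cells is recorded, up to isotopy, by telling
  for each dart \<open>d\<close> the relator \<open>cell d\<close> to which the 2-cell left of \<open>d\<close> is mapped, the
  position \<open>pos d\<close> of the letter of that relator to which \<open>d\<close> corresponds, and whether
  the 2-cell is mapped with preserved orientation (\<open>ori d\<close>), so that its boundary reads the
  relator, or with reversed orientation, so that it reads the inverse of the relator.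
\<close>

record ('d, 'r) diagram =
  darts :: "'d set"
  opp :: "'d \<Rightarrow> 'd"
  nxt :: "'d \<Rightarrow> 'd"
  cell :: "'d \<Rightarrow> 'r"
  pos :: "'d \<Rightarrow> nat"
  ori :: "'d \<Rightarrow> bool"

definition diagram_faces :: "('d, 'r) diagram \<Rightarrow> 'd set set" where
  "diagram_faces C = orbit (nxt C) ` darts C"

definition diagram_edges :: "('d, 'r) diagram \<Rightarrow> 'd set set" where
  "diagram_edges C = (\<lambda>d. {d, opp C d}) ` darts C"

definition diagram_vertices :: "('d, 'r) diagram \<Rightarrow> 'd set set" where
  "diagram_vertices C = orbit (nxt C \<circ> opp C) ` darts C"

definition dart_letter :: "('g, 'r) presentation \<Rightarrow> ('d, 'r) diagram \<Rightarrow> 'd \<Rightarrow> 'g letter" where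
  "dart_letter Q C d =
     (case relator Q (cell C d) ! pos C d of (a, \<epsilon>) \<Rightarrow> (a, if ori C d then \<epsilon> else \<not> \<epsilon>))"

definition edge_label :: "('g, 'r) presentation \<Rightarrow> ('d, 'r) diagram \<Rightarrow> 'd \<Rightarrow> 'g" where
  "edge_label Q C d = fst (dart_letter Q C d)"

definition sphere_cell_structure :: "('d, 'r) diagram \<Rightarrow> bool" where
  "sphere_cell_structure C \<longleftrightarrow>
     finite (darts C) \<and> darts C \<noteq> {} \<and>
     nxt C permutes darts C \<and> opp C permutes darts C \<and>
     (\<forall>d \<in> darts C. opp C d \<noteq> d \<and> opp C (opp C d) = d) \<and>
     (\<forall>d \<in> darts C. \<forall>d' \<in> darts C.
        (d, d') \<in> {(x, x'). x' = opp C x \<or> x' = nxt C x}\<^sup>*) \<and>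
     int (card (diagram_vertices C)) - int (card (diagram_edges C))
       + int (card (diagram_faces C)) = 2"

text \<open>
  In the following definition, the conditions on \<open>pos\<close> only force the boundary of a 2-cell to
  read a power of its relator; that the 2-cell is mapped homeomorphically, not as a branched
  cover, is the condition on the cardinality of the orbit.
\<close>

definition spherical_diagram :: "('g, 'r) presentation \<Rightarrow> ('d, 'r) diagram \<Rightarrow> bool" where
  "spherical_diagram Q C \<longleftrightarrow> sphere_cell_structure C \<and>
     (\<forall>d \<in> darts C.
        let n = length (relator Q (cell C d)) in
          cell C d \<in> rels Q \<and> pos C d < n \<and>
          cell C (nxt C d) = cell C d \<and> ori C (nxt C d) = ori C d \<and>
          pos C (nxt C d) = (if ori C d then pos C d + 1 else pos C d + n - 1) mod n \<and>
          card (orbit (nxt C) d) = n \<and>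
          dart_letter Q C (opp C d) = oinv (dart_letter Q C d))"

definition folding_edge :: "('d, 'r) diagram \<Rightarrow> 'd \<Rightarrow> bool" where
  "folding_edge C d \<longleftrightarrow> cell C (opp C d) = cell C d \<and> pos C (opp C d) = pos C d \<and>
     ori C (opp C d) \<noteq> ori C d"

text \<open>
  Since diagrams are finite, taking natural numbers as darts is no restriction.
\<close>

definition DR_directed_away_from :: "('g, 'r) presentation \<Rightarrow> 'g set \<Rightarrow> bool" where
  "DR_directed_away_from Q S \<longleftrightarrow> S \<subset> gens Q \<and>
     (\<forall>C :: (nat, 'r) diagram. spherical_diagram Q C \<longrightarrow>
        (\<exists>d \<in> darts C. edge_label Q C d \<notin> S) \<longrightarrow>
        (\<exists>d \<in> darts C. folding_edge C d \<and> edge_label Q C d \<notin> S))"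


section \<open>Labeled oriented trees\<close>

record ('v, 'e) labeled_graph =
  lgraph :: "('v, 'e) pre_digraph"
  elabel :: "'e \<Rightarrow> 'v"

definition LOT :: "('v, 'e) labeled_graph \<Rightarrow> bool" where
  "LOT L \<longleftrightarrow> fin_digraph (lgraph L) \<and> undirected_tree (lgraph L) \<and>
     elabel L ` arcs (lgraph L) \<subseteq> verts (lgraph L)"

definition LOT_presentation :: "('v, 'e) labeled_graph \<Rightarrow> ('v, 'e) presentation" where
  "LOT_presentation L =
    \<lparr> gens = verts (lgraph L),
      rels = arcs (lgraph L),
      relator = (\<lambda>e. let u1 = tail (lgraph L) e; u2 = head (lgraph L) e; u3 = elabel L e in
        [(u1, True), (u3, True), (u2, False), (u3, False)]) \<rparr>"

text \<open>
  The labels, like tail and head in \<^const>\<open>subgraph\<close>, are required to agree as functions. So a sub-LOT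
  is determined by its vertices and edges.
\<close>

definition sub_LOT :: "('v, 'e) labeled_graph \<Rightarrow> ('v, 'e) labeled_graph \<Rightarrow> bool" where
  "sub_LOT T L \<longleftrightarrow> subgraph (lgraph T) (lgraph L) \<and> elabel T = elabel L \<and>
     connected (lgraph T) \<and> arcs (lgraph T) \<noteq> {} \<and>
     elabel T ` arcs (lgraph T) \<subseteq> verts (lgraph T)"

definition maximal_proper_sub_LOT ::
    "('v, 'e) labeled_graph \<Rightarrow> ('v, 'e) labeled_graph \<Rightarrow> bool" where
  "maximal_proper_sub_LOT T L \<longleftrightarrow> sub_LOT T L \<and> T \<noteq> L \<and>
     (\<forall>T'. sub_LOT T' L \<and> T' \<noteq> L \<and> subgraph (lgraph T) (lgraph T') \<longrightarrow> T' = T)"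

definition collapse ::
    "('v, 'e) labeled_graph \<Rightarrow> ('v, 'e) labeled_graph \<Rightarrow> 'v \<Rightarrow> ('v, 'e) labeled_graph" where
  "collapse L T y =
    (let q = (\<lambda>x. if x \<in> verts (lgraph T) then y else x) in
     \<lparr> lgraph =
         \<lparr> verts = q ` verts (lgraph L),
           arcs = arcs (lgraph L) - arcs (lgraph T),
           tail = q \<circ> tail (lgraph L),
           head = q \<circ> head (lgraph L) \<rparr>,
       elabel = q \<circ> elabel L \<rparr>)"

end

theory Submission
  imports Defs "HOL-Library.Z2" "HOL-Library.Function_Algebras" "HOL-Library.Product_Plus"
begin

text \<open>
  After the collapse every relator of \<open>T\<close> reads \<open>y y y\<^sup>-\<^sup>1 y\<^sup>-\<^sup>1\<close>. In a spherical diagram over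
  \<open>K(P)\<close> each 2-cell of \<open>T\<close> can therefore be squeezed onto a path of two edges, by gluing the side
  labelled by its first letter to the one labelled by its last letter, and the second to the third.
  If all 2-cells of \<open>T\<close> are squeezed, the sphere becomes a tree-like union of spheres and arcs, and
  each of these spheres is a spherical diagram over the collapsed presentation. An edge with a label
  outside \<open>S\<close> bounds no 2-cell of \<open>T\<close>, so it lies on one of these spheres. There, reducibility away
  from \<open>y\<close> yields a folding edge whose label is not \<open>y\<close>. Only edges with labels in \<open>S\<close> have been
  glued, hence this is an edge of the original diagram between the same two 2-cells, and it is
  a folding edge there. This is \<open>DR_directed_away_from_collapse\<close>.

  For a combinatorial map, squeezing means to keep the darts of the other 2-cells, and to match each
  of them with the first kept dart that is reached by alternately crossing edges and squeezed
  2-cells. The delicate point is that every component of the result is again a sphere.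
  Following vertices, edges and faces through the gluing would need many case distinctions. Instead,
  a connected map has Euler characteristic 2 iff every cocycle modulo 2 has a potential
  (\<open>euler_char_2_iff_mod2_acyclic\<close>, a count of cochains), and this second property is inherited at
  once: a cocycle of the squeezed map extends to the old map, and the restriction of a potential of
  the extension is a potential (\<open>mod2_acyclic_squeezed\<close>).

  For the criteria, the corners around a vertex of a diagram form a closed edge path in
  the Whitehead graph, and the backtracks of this path are folding edges (\<open>corner_props\<close>). A closed
  edge path that backtracks at no more than one vertex \<open>w\<close> of a graph contains a reduced cycle that
  is not longer (\<open>closed_path_backtracking_at_one_vertex\<close>). If all folding edges were labelled \<open>y\<close>, all
  backtracks would occur at \<open>y\<^sup>+\<close> and \<open>y\<^sup>-\<close>. So it suffices to find a vertex of the diagram where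
  only one of these two can be a place of backtracks, and whose link lies in a part of the
  Whitehead graph without reduced cycles, or is shorter than all reduced cycles.

  \<^item> If \<open>W\<^sup>+\<close> or \<open>W\<^sup>-\<close> is a tree, such a vertex is a source or a sink. The relators have exponent
    sum zero, so that the vanishing of cohomology gives a height function, which excludes directed
    cycles. Modulo 2 this is not enough, but potentials modulo 2 can be iterated to potentials modulo
    any power of 2 (\<open>integral_potential_mod_power_2\<close>).
  \<^item> If there are no reduced cycles of length less than four, such a vertex is one of degree less than
    four, which exists since all 2-cells are quadrangles. Neighbouring edges at a vertex have
    different labels because the relators consist of three different generators, and among at most
    three edges any two are neighbours, so that at most one of them is labelled \<open>y\<close>.
\<close>

section \<open>Orbits of permutations and functions invariant under them\<close>

lemma card_kernel_times_card_image:
  fixes g :: "'a::ab_group_add \<Rightarrow> 'b::ab_group_add"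
  assumes fin: "finite G"
    and diff: "\<And>x y. x \<in> G \<Longrightarrow> y \<in> G \<Longrightarrow> x - y \<in> G"
    and hom: "\<And>x y. x \<in> G \<Longrightarrow> y \<in> G \<Longrightarrow> g (x - y) = g x - g y"
  shows "card G = card {x \<in> G. g x = 0} * card (g ` G)"
proof -
  have fibre: "card {x \<in> G. g x = b} = card {x \<in> G. g x = 0}" if b: "b \<in> g ` G" for b
  proof -
    obtain a where a: "a \<in> G" "g a = b" using b by auto
    have neg: "0 - a \<in> G" using diff[OF diff[OF a(1) a(1)] a(1)] by simp
    have zero: "0 \<in> G" using diff[OF a(1) a(1)] by simp
    have g0: "g 0 = 0" using hom[OF a(1) a(1)] by simp
    have add: "x + a \<in> G \<and> g (x + a) = g x + b" if "x \<in> G" for x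
      using diff[OF that neg] hom[OF that neg] hom[OF zero a(1)] a(2) g0 by simp
    have "bij_betw (\<lambda>x. x - a) {x \<in> G. g x = b} {x \<in> G. g x = 0}"
      by (rule bij_betw_byWitness[where f' = "\<lambda>x. x + a"])
         (use diff hom a add in auto)
    then show ?thesis by (rule bij_betw_same_card)
  qed
  have "card G = (\<Sum>b\<in>g ` G. card {x \<in> G. g x = b})"
    using sum.image_gen[OF fin, of "\<lambda>_. 1::nat" g] by simp
  also have "\<dots> = card {x \<in> G. g x = 0} * card (g ` G)"
    using fibre by simp
  finally show ?thesis .
qed

lemma permutes_orbit_eq_iff:
  assumes "p permutes D" "finite D"
  shows "orbit p x = orbit p y \<longleftrightarrow> x \<in> orbit p y"
proof -
  have per: "permutation p" using assms permutation_permutes by blast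
  show ?thesis
    using permutation_self_in_orbit[OF per] cyclic_on_orbit[OF assms] orbit_cyclic_eq3 by metis
qed

lemma sum_over_orbits:
  fixes g :: "'d \<Rightarrow> 'b::comm_monoid_add"
  assumes "p permutes D" "finite D"
  shows "(\<Sum>C\<in>orbit p ` D. \<Sum>x\<in>C. g x) = (\<Sum>x\<in>D. g x)"
proof -
  have per: "permutation p" using assms permutation_permutes by blast
  have U: "\<Union>(orbit p ` D) = D"
    using permutes_orbit_subset[OF assms(1)] permutation_self_in_orbit[OF per] by auto
  have fins: "\<forall>C\<in>orbit p ` D. finite C"
    using permutes_orbit_subset[OF assms(1)] finite_subset[OF _ assms(2)] by auto
  have disj: "\<forall>A\<in>orbit p ` D. \<forall>B\<in>orbit p ` D. A \<noteq> B \<longrightarrow> A \<inter> B = {}"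
    using permutes_orbit_eq_iff[OF assms] by blast
  have "(\<Sum>x\<in>\<Union>(orbit p ` D). g x) = (sum \<circ> sum) g (orbit p ` D)"
    by (rule sum.Union_disjoint[OF fins disj])
  then show ?thesis using U by (simp add: comp_def)
qed

lemma sum_orbit_shift:
  fixes g :: "'d \<Rightarrow> 'b::comm_monoid_add"
  assumes "p permutes D" "finite D"
  shows "(\<Sum>x\<in>orbit p d. g (p x)) = (\<Sum>x\<in>orbit p d. g x)"
proof -
  have per: "permutation p" using assms permutation_permutes by blast
  have "bij_betw p (orbit p d) (orbit p d)"
  proof (intro bij_betw_imageI)
    show "inj_on p (orbit p d)" using assms(1) permutes_inj inj_on_subset by blast
    then show "p ` orbit p d = orbit p d"
      using orbit.step[of _ p d] finite_orbit[OF permutation_self_in_orbit[OF per]]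
      by (intro endo_inj_surj) auto
  qed
  then show ?thesis by (rule sum.reindex_bij_betw)
qed

lemma permutes_orbit_card_return:
  assumes "p permutes D" "finite D"
  shows "(p ^^ card (orbit p d)) d = d"
proof -
  have per: "permutation p" using assms permutation_permutes by blast
  note self = permutation_self_in_orbit[OF per, of d]
  let ?k = "funpow_dist1 p d d"
  have "orbit p d = (\<lambda>j. (p ^^ j) d) ` {0..<?k}" by (rule orbit_conv_funpow_dist1[OF self])
  moreover have "inj_on (\<lambda>j. (p ^^ j) d) {0..<?k}" by (rule inj_on_funpow_dist1[OF self])
  ultimately have "card (orbit p d) = ?k" by (simp add: card_image)
  then show ?thesis using funpow_dist1_prop[OF self] by simp
qed

definition invariants :: "'d set \<Rightarrow> ('d \<Rightarrow> 'd) \<Rightarrow> ('d \<Rightarrow> bit) set" where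
  "invariants D p = {\<phi>. (\<forall>x. x \<notin> D \<longrightarrow> \<phi> x = 0) \<and> (\<forall>x\<in>D. \<phi> (p x) = \<phi> x)}"

lemma invariants_orbit:
  assumes "\<phi> \<in> invariants D p" "p permutes D" "x \<in> D" "z \<in> orbit p x"
  shows "\<phi> z = \<phi> x"
  using assms(4)
proof induction
  case base
  then show ?case using assms by (auto simp: invariants_def)
next
  case (step z)
  then show ?case using assms permutes_orbit_subset[OF assms(2,3)] by (auto simp: invariants_def)
qed

text \<open>
  In this way invariant functions are counted, and generated from single orbits, further below.
\<close>

lemma invariants_indicator:
  assumes phi: "\<phi> \<in> invariants D p" and p: "p permutes D" "finite D"
  shows "(\<lambda>x. if x \<in> \<Union>(orbit p ` {x \<in> D. \<phi> x = 1}) then 1 else 0) = \<phi>"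
proof
  fix x
  have per: "permutation p" using p permutation_permutes by blast
  have "x \<in> \<Union>(orbit p ` {x \<in> D. \<phi> x = 1}) \<longleftrightarrow> \<phi> x = 1"
  proof
    assume "x \<in> \<Union>(orbit p ` {x \<in> D. \<phi> x = 1})"
    then show "\<phi> x = 1" using invariants_orbit[OF phi p(1)] by auto
  next
    assume a: "\<phi> x = 1"
    then have "x \<in> D" using phi by (auto simp: invariants_def)
    then show "x \<in> \<Union>(orbit p ` {x \<in> D. \<phi> x = 1})"
      using a permutation_self_in_orbit[OF per] by blast
  qed
  then show "(if x \<in> \<Union>(orbit p ` {x \<in> D. \<phi> x = 1}) then 1 else 0) = \<phi> x"
    by (cases "\<phi> x") auto
qed

lemma card_invariants:
  assumes "p permutes D" "finite D"
  shows "card (invariants D p) = 2 ^ card (orbit p ` D)" and "finite (invariants D p)"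
proof -
  have per: "permutation p" using assms permutation_permutes by blast
  note self = permutation_self_in_orbit[OF per]
  have fin: "finite (orbit p ` D)" using assms by simp
  have bij: "bij_betw (\<lambda>X x. if x \<in> \<Union>X then 1 else 0) (Pow (orbit p ` D)) (invariants D p)"
  proof (rule bij_betw_byWitness[where f' = "\<lambda>\<phi>. orbit p ` {x \<in> D. \<phi> x = 1}"])
    show "\<forall>X\<in>Pow (orbit p ` D). orbit p ` {x \<in> D. (if x \<in> \<Union>X then 1 else 0::bit) = 1} = X"
    proof
      fix X assume X: "X \<in> Pow (orbit p ` D)"
      have sub: "\<Union>X \<subseteq> D" using X permutes_orbit_subset[OF assms(1)] by auto
      have "orbit p x \<in> X" if xX: "x \<in> \<Union>X" for x
      proof -
        obtain C where C: "C \<in> X" "x \<in> C" using xX by blast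
        then obtain c where "C = orbit p c" using X by auto
        then have "orbit p x = C" using C(2) permutes_orbit_eq_iff[OF assms] by simp
        then show ?thesis using C(1) by simp
      qed
      moreover have "C \<in> orbit p ` \<Union>X" if C: "C \<in> X" for C
      proof -
        obtain c where c: "C = orbit p c" using X C by auto
        then have "c \<in> \<Union>X" using self C by blast
        then show ?thesis using c by blast
      qed
      ultimately have "orbit p ` \<Union>X = X" by blast
      moreover have "{x \<in> D. (if x \<in> \<Union>X then 1 else 0::bit) = 1} = \<Union>X" using sub by auto
      ultimately show "orbit p ` {x \<in> D. (if x \<in> \<Union>X then 1 else 0::bit) = 1} = X" by simp
    qed
    show "\<forall>\<phi>\<in>invariants D p. (\<lambda>x. if x \<in> \<Union>(orbit p ` {x \<in> D. \<phi> x = 1}) then 1 else 0) = \<phi>"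
      using invariants_indicator[OF _ assms] by blast
    show "(\<lambda>X x. if x \<in> \<Union>X then 1 else 0) ` Pow (orbit p ` D) \<subseteq> invariants D p"
    proof safe
      fix X assume X: "X \<subseteq> orbit p ` D"
      have "p x \<in> \<Union>X \<longleftrightarrow> x \<in> \<Union>X" for x
      proof -
        have "p x \<in> C \<longleftrightarrow> x \<in> C" if C: "C \<in> X" for C
        proof -
          obtain c where "C = orbit p c" using X C by blast
          then show ?thesis
            using permutes_orbit_eq_iff[OF assms, of "p x" c] permutes_orbit_eq_iff[OF assms, of x c]
              permutation_orbit_step[OF per, of x] by simp
        qed
        then show ?thesis by blast
      qed
      moreover have "\<Union>X \<subseteq> D" using X permutes_orbit_subset[OF assms(1)] by auto
      ultimately show "(\<lambda>x. if x \<in> \<Union>X then 1 else 0) \<in> invariants D p"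
        unfolding invariants_def by auto
    qed
    show "(\<lambda>\<phi>. orbit p ` {x \<in> D. \<phi> x = 1}) ` invariants D p \<subseteq> Pow (orbit p ` D)" by auto
  qed
  show "card (invariants D p) = 2 ^ card (orbit p ` D)"
    using bij_betw_same_card[OF bij] card_Pow[OF fin] by simp
  show "finite (invariants D p)"
    using bij_betw_finite[OF bij] fin by simp
qed

lemma invariants_diff: "\<phi> \<in> invariants D p \<Longrightarrow> \<psi> \<in> invariants D p \<Longrightarrow> \<phi> - \<psi> \<in> invariants D p"
  by (auto simp: invariants_def)


section \<open>Euler characteristic two as vanishing of mod 2 cohomology\<close>

text \<open>
  The summands cancel in pairs.
\<close>

lemma sum_bit_involution:
  fixes g :: "'d \<Rightarrow> bit"
  assumes "finite A"
    and "\<And>x. x \<in> A \<Longrightarrow> s x \<in> A" "\<And>x. x \<in> A \<Longrightarrow> s x \<noteq> x" "\<And>x. x \<in> A \<Longrightarrow> s (s x) = x"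
    and "\<And>x. x \<in> A \<Longrightarrow> g (s x) = g x"
  shows "(\<Sum>x\<in>A. g x) = 0"
  using assms
proof (induction A rule: finite_psubset_induct)
  case (psubset A)
  show ?case
  proof (cases "A = {}")
    case False
    then obtain x where x: "x \<in> A" by blast
    have neq: "s x \<noteq> x" using psubset.prems(2)[OF x] .
    have sx: "s x \<in> A" using psubset.prems(1)[OF x] .
    have rest: "s z \<noteq> x" "s z \<noteq> s x" if "z \<in> A" "z \<noteq> x" "z \<noteq> s x" for z
      using that psubset.prems(3) x by metis+
    have "(\<Sum>z\<in>A - {x, s x}. g z) = 0"
      by (rule psubset.IH) (use x psubset.prems rest in auto)
    moreover have "(\<Sum>z\<in>{x, s x}. g z) = 0"
      using neq psubset.prems(4)[OF x] by simp
    moreover have "(\<Sum>z\<in>A. g z) = (\<Sum>z\<in>A - {x, s x}. g z) + (\<Sum>z\<in>{x, s x}. g z)"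
      by (rule sum.subset_diff) (use x sx psubset.hyps in auto)
    ultimately show ?thesis by simp
  qed simp
qed

text \<open>
  The maps used for cell structures on closed oriented surfaces, with darts \<open>D\<close>: \<open>e\<close> reverses a dart and
  \<open>f\<close> moves on along the face to its left.
\<close>

locale combinatorial_map =
  fixes D :: "'d set" and e f :: "'d \<Rightarrow> 'd"
  assumes fin: "finite D"
    and f_perm: "f permutes D"
    and e_perm: "e permutes D"
    and e_neq: "d \<in> D \<Longrightarrow> e d \<noteq> d"
    and e_e: "d \<in> D \<Longrightarrow> e (e d) = d"
begin

text \<open>
  The vanishing of the first cohomology group with coefficients in the field of two elements. A
  1-cochain is an \<open>e\<close>-invariant function \<open>\<alpha>\<close> on darts, a 0-cochain \<open>h\<close> is evaluated at
  the start of a dart. The dart \<open>f d\<close> starts where \<open>d\<close> ends, like \<open>e d\<close>; the equation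
  \<open>h (f d) = h (e d)\<close> thus says that \<open>h\<close> is a function of vertices.
\<close>

definition mod2_acyclic :: bool where
  "mod2_acyclic \<longleftrightarrow> (\<forall>\<alpha>::'d \<Rightarrow> bit.
     (\<forall>d\<in>D. \<alpha> (e d) = \<alpha> d) \<and> (\<forall>d\<in>D. (\<Sum>x\<in>orbit f d. \<alpha> x) = 0) \<longrightarrow>
     (\<exists>h::'d \<Rightarrow> bit. \<forall>d\<in>D. h (e d) = h d + \<alpha> d \<and> h (f d) = h (e d)))"

definition linked :: "'d set \<Rightarrow> bool" where
  "linked X \<longleftrightarrow> (\<forall>d\<in>X. \<forall>d'\<in>X. (d, d') \<in> {(x, x'). x' = e x \<or> x' = f x}\<^sup>*)"

lemma e_in [simp]: "e d \<in> D \<longleftrightarrow> d \<in> D" by (rule permutes_in_image[OF e_perm])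
lemma f_in [simp]: "f d \<in> D \<longleftrightarrow> d \<in> D" by (rule permutes_in_image[OF f_perm])

lemma v_perm: "(f \<circ> e) permutes D" by (rule permutes_compose[OF e_perm f_perm])

lemma face_subset: "d \<in> D \<Longrightarrow> orbit f d \<subseteq> D"
  using permutes_orbit_subset[OF f_perm] by blast

lemma orbit_e: "d \<in> D \<Longrightarrow> orbit e d = {d, e d}"
proof
  assume d: "d \<in> D"
  show "orbit e d \<subseteq> {d, e d}"
  proof
    fix x assume "x \<in> orbit e d"
    then show "x \<in> {d, e d}" by induction (use d e_e in auto)
  qed
  show "{d, e d} \<subseteq> orbit e d"
    using orbit.base[of e d] orbit.step[OF orbit.base[of e d]] d e_e by auto
qed

lemma card_darts: "card D = 2 * card (orbit e ` D)"
proof -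
  have "(\<Sum>C\<in>orbit e ` D. card C) = card D"
    using sum_over_orbits[OF e_perm fin, of "\<lambda>_. 1::nat"] by simp
  moreover have "card C = 2" if C: "C \<in> orbit e ` D" for C
  proof -
    obtain d where "d \<in> D" "C = {d, e d}" using C orbit_e by blast
    then show ?thesis using e_neq[of d] by simp
  qed
  ultimately show ?thesis by simp
qed

lemma sum_darts_edge_invariant:
  fixes \<alpha> :: "'d \<Rightarrow> bit"
  assumes "\<forall>d\<in>D. \<alpha> (e d) = \<alpha> d"
  shows "(\<Sum>x\<in>D. \<alpha> x) = 0"
  by (rule sum_bit_involution[where s = e]) (use assms fin e_neq e_e in auto)

text \<open>
  The coboundary maps. Cochains are represented by functions on darts that vanish outside \<open>D\<close> and are
  invariant under \<open>f \<circ> e\<close>, \<open>e\<close> or \<open>f\<close>, for functions of vertices, edges and faces, respectively.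
\<close>

definition \<delta>0 :: "('d \<Rightarrow> bit) \<Rightarrow> 'd \<Rightarrow> bit" where
  "\<delta>0 h = (\<lambda>d. if d \<in> D then h (e d) - h d else 0)"

definition \<delta>1 :: "('d \<Rightarrow> bit) \<Rightarrow> 'd \<Rightarrow> bit" where
  "\<delta>1 \<alpha> = (\<lambda>d. if d \<in> D then \<Sum>x\<in>orbit f d. \<alpha> x else 0)"

lemma inv_v_iff: "h \<in> invariants D (f \<circ> e) \<longleftrightarrow> (\<forall>x. x \<notin> D \<longrightarrow> h x = 0) \<and> (\<forall>d\<in>D. h (f d) = h (e d))"
  unfolding invariants_def using e_e by (auto, metis e_e e_in)

lemma \<delta>0_cocycle:
  assumes h: "h \<in> invariants D (f \<circ> e)"
  shows "\<delta>0 h \<in> {\<alpha> \<in> invariants D e. \<delta>1 \<alpha> = 0}"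
proof -
  have "\<delta>0 h \<in> invariants D e"
    unfolding \<delta>0_def invariants_def using e_e by (auto simp: add.commute)
  moreover have "\<delta>1 (\<delta>0 h) = 0"
  proof
    fix d
    show "\<delta>1 (\<delta>0 h) d = 0 d"
    proof (cases "d \<in> D")
      case True
      have "(\<Sum>x\<in>orbit f d. \<delta>0 h x) = (\<Sum>x\<in>orbit f d. h (f x) - h x)"
        using face_subset[OF True] h by (intro sum.cong) (auto simp: \<delta>0_def inv_v_iff)
      also have "\<dots> = 0"
        unfolding sum_subtractf using sum_orbit_shift[OF f_perm fin, of h d] by simp
      finally show ?thesis using True by (simp add: \<delta>1_def)
    qed (simp add: \<delta>1_def)
  qed
  ultimately show ?thesis by simp
qed

lemma mod2_acyclic_iff:
  "mod2_acyclic \<longleftrightarrow> \<delta>0 ` invariants D (f \<circ> e) = {\<alpha> \<in> invariants D e. \<delta>1 \<alpha> = 0}"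
proof
  assume ac: mod2_acyclic
  have "\<alpha> \<in> \<delta>0 ` invariants D (f \<circ> e)" if "\<alpha> \<in> invariants D e" "\<delta>1 \<alpha> = 0" for \<alpha>
  proof -
    have "\<forall>d\<in>D. \<alpha> (e d) = \<alpha> d" using that(1) by (auto simp: invariants_def)
    moreover have "\<forall>d\<in>D. (\<Sum>x\<in>orbit f d. \<alpha> x) = 0"
      using that(2) by (metis \<delta>1_def zero_fun_apply)
    ultimately obtain h :: "'d \<Rightarrow> bit" where h: "\<forall>d\<in>D. h (e d) = h d + \<alpha> d \<and> h (f d) = h (e d)"
      using ac unfolding mod2_acyclic_def by blast
    define h' where "h' = (\<lambda>d. if d \<in> D then h d else 0)"
    have "h' \<in> invariants D (f \<circ> e)" unfolding inv_v_iff h'_def using h by auto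
    moreover have "\<alpha> = \<delta>0 h'"
      using h that(1) by (auto simp: fun_eq_iff \<delta>0_def h'_def invariants_def add.assoc[symmetric])
    ultimately show ?thesis by blast
  qed
  then show "\<delta>0 ` invariants D (f \<circ> e) = {\<alpha> \<in> invariants D e. \<delta>1 \<alpha> = 0}"
    using \<delta>0_cocycle by blast
next
  assume eq: "\<delta>0 ` invariants D (f \<circ> e) = {\<alpha> \<in> invariants D e. \<delta>1 \<alpha> = 0}"
  show mod2_acyclic
    unfolding mod2_acyclic_def
  proof (intro allI impI)
    fix \<alpha> :: "'d \<Rightarrow> bit"
    assume a: "(\<forall>d\<in>D. \<alpha> (e d) = \<alpha> d) \<and> (\<forall>d\<in>D. (\<Sum>x\<in>orbit f d. \<alpha> x) = 0)"
    define \<alpha>' where "\<alpha>' = (\<lambda>d. if d \<in> D then \<alpha> d else 0)"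
    have "(\<Sum>x\<in>orbit f d. \<alpha>' x) = (\<Sum>x\<in>orbit f d. \<alpha> x)" if "d \<in> D" for d
      using face_subset[OF that] by (intro sum.cong) (auto simp: \<alpha>'_def)
    then have "\<alpha>' \<in> {\<alpha> \<in> invariants D e. \<delta>1 \<alpha> = 0}"
      using a by (auto simp: invariants_def \<alpha>'_def \<delta>1_def fun_eq_iff)
    then obtain h where h: "h \<in> invariants D (f \<circ> e)" "\<alpha>' = \<delta>0 h" unfolding eq[symmetric] by blast
    have "h (e d) = h d + \<alpha> d" if "d \<in> D" for d
    proof -
      have "\<alpha> d = h (e d) - h d" using h(2) that by (metis \<alpha>'_def \<delta>0_def)
      then show ?thesis by (metis add.commute diff_add_cancel)
    qed
    then show "\<exists>h. \<forall>d\<in>D. h (e d) = h d + \<alpha> d \<and> h (f d) = h (e d)"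
      using h(1) unfolding inv_v_iff by blast
  qed
qed

lemma connected_propagate:
  assumes conn: "linked D" and d: "d \<in> D" "d' \<in> D" and P: "P d"
    and "\<And>x. x \<in> D \<Longrightarrow> P x \<Longrightarrow> P (e x)" "\<And>x. x \<in> D \<Longrightarrow> P x \<Longrightarrow> P (f x)"
  shows "P d'"
proof -
  have "(d, d') \<in> {(x, x'). x' = e x \<or> x' = f x}\<^sup>*"
    using conn d by (auto simp: linked_def)
  then have "d' \<in> D \<and> P d'"
    by induction (use assms in auto)
  then show ?thesis by simp
qed

text \<open>
  In a connected map the only functions of vertices without coboundary are the two constants.
\<close>

lemma card_coboundaries:
  assumes conn: "linked D" and ne: "D \<noteq> {}"
  shows "2 ^ card (orbit (f \<circ> e) ` D) = 2 * card (\<delta>0 ` invariants D (f \<circ> e))"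
proof -
  obtain d0 where d0: "d0 \<in> D" using ne by blast
  define one :: "'d \<Rightarrow> bit" where "one = (\<lambda>d. if d \<in> D then 1 else 0)"
  have "{h \<in> invariants D (f \<circ> e). \<delta>0 h = 0} = {0, one}"
  proof (intro equalityI subsetI)
    fix h assume "h \<in> {h \<in> invariants D (f \<circ> e). \<delta>0 h = 0}"
    then have h: "h \<in> invariants D (f \<circ> e)" and dh: "\<delta>0 h = 0" by auto
    have he: "h (e x) = h x" if "x \<in> D" for x
    proof -
      have "h (e x) - h x = 0" using fun_cong[OF dh, of x] that by (simp add: \<delta>0_def)
      then show ?thesis by (metis eq_iff_diff_eq_0)
    qed
    have "h d = h d0" if "d \<in> D" for d
      by (rule connected_propagate[OF conn d0 that, where P = "\<lambda>x. h x = h d0"])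
         (use h he in \<open>auto simp: inv_v_iff\<close>)
    then have "h = (\<lambda>d. if d \<in> D then h d0 else 0)" using h by (auto simp: inv_v_iff)
    then show "h \<in> {0, one}" by (cases "h d0") (auto simp: one_def fun_eq_iff)
  qed (auto simp: invariants_def one_def \<delta>0_def fun_eq_iff)
  moreover have "0 \<noteq> one" using d0 by (auto simp: one_def fun_eq_iff)
  ultimately have "card {h \<in> invariants D (f \<circ> e). \<delta>0 h = 0} = 2" by simp
  moreover have "card (invariants D (f \<circ> e)) =
     card {h \<in> invariants D (f \<circ> e). \<delta>0 h = 0} * card (\<delta>0 ` invariants D (f \<circ> e))"
    by (rule card_kernel_times_card_image)
       (use card_invariants(2)[OF v_perm fin] in \<open>auto simp: invariants_diff \<delta>0_def fun_eq_iff add_ac simp del: minus_bit_def\<close>)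
  ultimately show ?thesis using card_invariants(1)[OF v_perm fin] by simp
qed


text \<open>
  In a connected map the image of \<open>\<delta>1\<close> has index 2 in the functions of faces. It has at most this index
  since the coboundary of one edge is the sum of its two faces, so that any two faces are
  congruent modulo the image. It is not everything since the values of \<open>\<delta>1 \<alpha>\<close> on the faces sum up to
  zero, each edge being counted twice. Both parts are expressed by one homomorphism \<open>\<Psi>\<close>, which maps an
  additional bit to a multiple of a fixed face and is surjective with kernel the cocycles.
\<close>

lemma card_cocycles:
  assumes conn: "linked D" and ne: "D \<noteq> {}"
  shows "2 * 2 ^ card (orbit e ` D) =
    card {\<alpha> \<in> invariants D e. \<delta>1 \<alpha> = 0} * 2 ^ card (orbit f ` D)"
proof -
  obtain d0 where d0: "d0 \<in> D" using ne by blast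
  have per: "permutation f" using f_perm fin permutation_permutes by blast
  note self = permutation_self_in_orbit[OF per]
  note same = permutes_orbit_eq_iff[OF f_perm fin]
  define face :: "'d \<Rightarrow> 'd \<Rightarrow> bit" where "face d = (\<lambda>x. if x \<in> orbit f d then 1 else 0)" for d
  define \<Psi> where "\<Psi> = (\<lambda>(\<alpha>, c::bit). \<delta>1 \<alpha> - (if c = 1 then face d0 else 0))"
  let ?G = "invariants D e \<times> (UNIV :: bit set)"
  have univ: "(UNIV :: bit set) = {0, 1}" using bit.exhaust by auto
  have fin1: "finite (invariants D e)" and card1: "card (invariants D e) = 2 ^ card (orbit e ` D)"
    using card_invariants[OF e_perm fin] by auto
  have bits: "finite (UNIV :: bit set)" "card (UNIV :: bit set) = 2" unfolding univ by simp_all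
  have finG: "finite ?G" using fin1 bits by simp
  have diff1: "\<delta>1 (\<alpha> - \<beta>) = \<delta>1 \<alpha> - \<delta>1 \<beta>" for \<alpha> \<beta>
    by (auto simp: \<delta>1_def fun_eq_iff sum_subtractf simp del: minus_bit_def)
  have hom: "\<Psi> (p - q) = \<Psi> p - \<Psi> q" for p q
  proof -
    obtain \<alpha> c \<beta> c' where pq: "p = (\<alpha>, c)" "q = (\<beta>, c')" by (metis surj_pair)
    have "(if c - c' = 1 then face d0 else 0) = (if c = 1 then face d0 else 0) - (if c' = 1 then face d0 else 0)"
      by (cases c; cases c') (auto simp: fun_eq_iff)
    then show ?thesis by (simp add: pq \<Psi>_def diff1)
  qed
  have \<delta>1_face: "\<delta>1 \<alpha> \<in> invariants D f" for \<alpha>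
    unfolding invariants_def \<delta>1_def using permutation_orbit_step[OF per] by auto
  have face_in: "face d \<in> invariants D f" if "d \<in> D" for d
  proof -
    have "f x \<in> orbit f d \<longleftrightarrow> x \<in> orbit f d" for x
      using same[of "f x" d] same[of x d] permutation_orbit_step[OF per, of x] by simp
    then show ?thesis unfolding invariants_def face_def using face_subset[OF that] by auto
  qed
  have kernel: "{p \<in> ?G. \<Psi> p = 0} = {\<alpha> \<in> invariants D e. \<delta>1 \<alpha> = 0} \<times> {0}"
  proof (intro equalityI subsetI)
    fix p assume "p \<in> {p \<in> ?G. \<Psi> p = 0}"
    then obtain \<alpha> c where p: "p = (\<alpha>, c)" "\<alpha> \<in> invariants D e" "\<Psi> (\<alpha>, c) = 0" by auto
    have "c \<noteq> 1"
    proof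
      assume c: "c = 1"
      have d1: "\<delta>1 \<alpha> = face d0"
        using p(3) c by (simp add: \<Psi>_def)
      have faces: "(\<Sum>x\<in>C. \<alpha> x) = (if orbit f d0 = C then 1 else 0)" if C: "C \<in> orbit f ` D" for C
      proof -
        obtain d where d: "d \<in> D" "C = orbit f d" using C by auto
        have "(\<Sum>x\<in>C. \<alpha> x) = face d0 d" using fun_cong[OF d1, of d] d by (simp add: \<delta>1_def)
        moreover have "d \<in> orbit f d0 \<longleftrightarrow> orbit f d0 = orbit f d" using same by metis
        ultimately show ?thesis using d(2) by (simp add: face_def)
      qed
      have "(\<Sum>x\<in>D. \<alpha> x) = (\<Sum>C\<in>orbit f ` D. if orbit f d0 = C then 1 else 0)"
        by (rule trans[OF sum_over_orbits[OF f_perm fin, of \<alpha>, symmetric] sum.cong[OF refl faces]])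
      also have "\<dots> = (if orbit f d0 \<in> orbit f ` D then 1 else 0)"
        by (rule sum.delta') (use fin in simp)
      also have "\<dots> = 1" using d0 by simp
      finally have "(\<Sum>x\<in>D. \<alpha> x) = 1" .
      moreover have "(\<Sum>x\<in>D. \<alpha> x) = 0"
        using p(2) by (intro sum_darts_edge_invariant) (auto simp: invariants_def)
      ultimately show False by simp
    qed
    then have "c = 0" by simp
    then show "p \<in> {\<alpha> \<in> invariants D e. \<delta>1 \<alpha> = 0} \<times> {0}" using p by (simp add: \<Psi>_def)
  next
    fix p assume "p \<in> {\<alpha> \<in> invariants D e. \<delta>1 \<alpha> = 0} \<times> {0 :: bit}"
    then show "p \<in> {p \<in> ?G. \<Psi> p = 0}" by (auto simp: \<Psi>_def)
  qed
  have closed: "p - q \<in> ?G" if "p \<in> ?G" "q \<in> ?G" for p q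
    using that invariants_diff by auto
  have im_diff: "x - z \<in> \<Psi> ` ?G" if xz: "x \<in> \<Psi> ` ?G" "z \<in> \<Psi> ` ?G" for x z
  proof -
    obtain p q where p: "p \<in> ?G" "x = \<Psi> p" and q: "q \<in> ?G" "z = \<Psi> q" using xz by blast
    then have "x - z = \<Psi> (p - q)" using hom by simp
    then show ?thesis using closed[OF p(1) q(1)] by (rule image_eqI)
  qed
  have zero_inv: "0 \<in> invariants D q" for q by (simp add: invariants_def)
  have zero_im: "0 \<in> \<Psi> ` ?G"
  proof (rule image_eqI)
    show "0 = \<Psi> 0" using hom[of 0 0] by simp
    show "0 \<in> ?G" using zero_inv by (simp add: zero_prod_def)
  qed
  have im_add: "x + z \<in> \<Psi> ` ?G" if "x \<in> \<Psi> ` ?G" "z \<in> \<Psi> ` ?G" for x z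
    using im_diff[OF that(1) im_diff[OF zero_im that(2)]] by simp
  have face_im: "face d \<in> \<Psi> ` ?G" if "d \<in> D" for d
  proof (rule connected_propagate[OF conn d0 that, where P = "\<lambda>x. face x \<in> \<Psi> ` ?G"])
    have "\<delta>1 0 = 0" using diff1[of 0 0] by simp
    moreover have "0 - face d0 = face d0" by (simp add: fun_eq_iff)
    ultimately have "face d0 = \<Psi> (0, 1)" by (simp add: \<Psi>_def)
    moreover have "(0, 1) \<in> ?G" using zero_inv by simp
    ultimately show "face d0 \<in> \<Psi> ` ?G" by (rule image_eqI)
  next
    fix x assume x: "x \<in> D" "face x \<in> \<Psi> ` ?G"
    have "face (f x) = face x" using permutation_orbit_step[OF per, of x] by (simp add: face_def)
    then show "face (f x) \<in> \<Psi> ` ?G" using x by simp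
    \<comment> \<open>the cochain of the edge of \<open>x\<close>, whose coboundary is the sum of the faces at both sides\<close>
    define \<alpha> :: "'d \<Rightarrow> bit" where "\<alpha> = (\<lambda>z. if z = x \<or> z = e x then 1 else 0)"
    have "\<alpha> \<in> invariants D e"
    proof -
      have "e z = x \<longleftrightarrow> z = e x" if "z \<in> D" for z using e_e[OF that] e_e[OF x(1)] by metis
      moreover have "e z = e x \<longleftrightarrow> z = x" for z using permutes_inj[OF e_perm] by (auto dest: injD)
      ultimately show ?thesis unfolding invariants_def \<alpha>_def using x(1) by auto
    qed
    moreover have "\<delta>1 \<alpha> = face x + face (e x)"
    proof
      fix d
      show "\<delta>1 \<alpha> d = (face x + face (e x)) d"
      proof (cases "d \<in> D")
        case True
        have "(\<Sum>z\<in>orbit f d. \<alpha> z) = (\<Sum>z\<in>orbit f d. (if z = x then 1 else 0) + (if z = e x then 1 else 0))"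
          using e_neq[OF x(1)] by (intro sum.cong) (auto simp: \<alpha>_def)
        also have "\<dots> = (if x \<in> orbit f d then 1 else 0) + (if e x \<in> orbit f d then 1 else 0)"
          using finite_orbit[OF self[of d]] by (simp only: sum.distrib sum.delta)
        also have "\<dots> = face x d + face (e x) d"
        proof -
          have "z \<in> orbit f d \<longleftrightarrow> d \<in> orbit f z" for z using same[of z d] same[of d z] by metis
          then show ?thesis by (simp only: face_def)
        qed
        finally show ?thesis using True by (simp add: \<delta>1_def)
      next
        case False
        then have "d \<notin> orbit f x" "d \<notin> orbit f (e x)"
          using face_subset[OF x(1)] face_subset[of "e x"] x(1) by auto
        then show ?thesis using False by (simp add: \<delta>1_def face_def)
      qed
    qed
    ultimately have "face x + face (e x) \<in> \<Psi> ` ?G"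
      by (intro image_eqI[where x = "(\<alpha>, 0)"]) (simp_all add: \<Psi>_def)
    from im_diff[OF this x(2)] show "face (e x) \<in> \<Psi> ` ?G" by (metis add_diff_cancel_left')
  qed
  have surj: "\<Psi> ` ?G = invariants D f"
  proof
    show "\<Psi> ` ?G \<subseteq> invariants D f"
    proof
      fix z assume "z \<in> \<Psi> ` ?G"
      then obtain \<alpha> c where z: "z = \<delta>1 \<alpha> - (if c = (1::bit) then face d0 else 0)"
        by (auto simp: \<Psi>_def)
      show "z \<in> invariants D f" unfolding z
        by (intro invariants_diff \<delta>1_face) (use face_in[OF d0] zero_inv in simp)
    qed
    have span: "(\<lambda>x. if x \<in> \<Union>X then 1 else 0) \<in> \<Psi> ` ?G" if X: "finite X" "X \<subseteq> orbit f ` D" for X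
      using X
    proof induction
      case empty
      have "(\<lambda>x. if x \<in> \<Union>{} then 1 else 0) = (0 :: 'd \<Rightarrow> bit)" by auto
      then show ?case using zero_im by simp
    next
      case (insert C X)
      obtain d where d: "d \<in> D" "C = orbit f d" using insert.prems by auto
      have "C \<inter> C' = {}" if C': "C' \<in> X" for C'
      proof -
        obtain d' where "C' = orbit f d'" using insert.prems C' by auto
        moreover have "C' \<noteq> C" using insert.hyps C' by auto
        ultimately show ?thesis using d(2) same by blast
      qed
      then have "(\<lambda>x. if x \<in> \<Union>(insert C X) then 1 else 0) =
          face d + (\<lambda>x. if x \<in> \<Union>X then 1 else 0)"
        using d(2) by (fastforce simp: face_def fun_eq_iff)
      then show ?case using im_add[OF face_im[OF d(1)]] insert by auto
    qed
    show "invariants D f \<subseteq> \<Psi> ` ?G"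
    proof
      fix \<phi> assume phi: "\<phi> \<in> invariants D f"
      let ?X = "orbit f ` {x \<in> D. \<phi> x = 1}"
      have "(\<lambda>x. if x \<in> \<Union>?X then 1 else 0) = \<phi>"
        by (rule invariants_indicator[OF phi f_perm fin])
      moreover have "(\<lambda>x. if x \<in> \<Union>?X then 1 else 0) \<in> \<Psi> ` ?G"
        by (rule span) (use fin in auto)
      ultimately show "\<phi> \<in> \<Psi> ` ?G" by simp
    qed
  qed
  have "card ?G = card {p \<in> ?G. \<Psi> p = 0} * card (\<Psi> ` ?G)"
  proof (rule card_kernel_times_card_image)
    show "finite ?G" by (rule finG)
    show "p - q \<in> ?G" if "p \<in> ?G" "q \<in> ?G" for p q using that by (rule closed)
    show "\<Psi> (p - q) = \<Psi> p - \<Psi> q" for p q by (rule hom)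
  qed
  moreover have "card ?G = 2 * 2 ^ card (orbit e ` D)"
    unfolding card_cartesian_product card1 bits by (rule mult.commute)
  ultimately show ?thesis
    unfolding kernel surj card_invariants(1)[OF f_perm fin] card_cartesian_product by simp
qed

text \<open>
  There are \<open>2 ^ (V - 1)\<close> coboundaries and \<open>2 ^ (E + 1 - F)\<close> cocycles, and all coboundaries are cocycles.
\<close>

theorem euler_char_2_iff_mod2_acyclic:
  assumes conn: "linked D" and ne: "D \<noteq> {}"
  shows "card (orbit (f \<circ> e) ` D) + card (orbit f ` D) = card (orbit e ` D) + 2 \<longleftrightarrow> mod2_acyclic"
proof -
  let ?B = "\<delta>0 ` invariants D (f \<circ> e)" and ?Z = "{\<alpha> \<in> invariants D e. \<delta>1 \<alpha> = 0}"
  let ?V = "card (orbit (f \<circ> e) ` D)" and ?E = "card (orbit e ` D)" and ?F = "card (orbit f ` D)"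
  have "finite ?Z" using card_invariants(2)[OF e_perm fin] by simp
  moreover have "?B \<subseteq> ?Z" using \<delta>0_cocycle by blast
  ultimately have "mod2_acyclic \<longleftrightarrow> card ?B = card ?Z"
    unfolding mod2_acyclic_iff using card_subset_eq[of ?Z ?B] by (auto simp only:)
  also have "\<dots> \<longleftrightarrow> 2 * (card ?B * 2 ^ ?F) = 2 * (card ?Z * 2 ^ ?F)" by simp
  also have "2 * (card ?B * 2 ^ ?F) = 2 ^ (?V + ?F)"
    using card_coboundaries[OF assms] by (simp add: power_add)
  also have "2 * (card ?Z * 2 ^ ?F) = 2 ^ (?E + 2)"
    using card_cocycles[OF assms] by simp
  also have "(2::nat) ^ (?V + ?F) = 2 ^ (?E + 2) \<longleftrightarrow> ?V + ?F = ?E + 2"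
    by (rule power_inject_exp) simp
  finally show ?thesis by simp
qed

end

section \<open>Connected components\<close>

lemma orbit_perm_restrict:
  assumes "d \<in> X" "\<And>x. x \<in> X \<Longrightarrow> g x \<in> X"
  shows "orbit (perm_restrict g X) d = orbit g d"
  by (rule orbit_cong0[of _ X]) (use assms in \<open>auto simp: perm_restrict_def\<close>)

context combinatorial_map begin

text \<open>
  Reachability is symmetric because a step of the permutation \<open>f\<close> is undone by further steps of \<open>f\<close>.
\<close>

lemma linked_sym:
  assumes "(x, z) \<in> {(x, x'). x' = e x \<or> x' = f x}\<^sup>*" "x \<in> D"
  shows "z \<in> D \<and> (z, x) \<in> {(x, x'). x' = e x \<or> x' = f x}\<^sup>*"
  using assms(1)
proof induction
  case (step y z)
  let ?r = "{(x, x'). x' = e x \<or> x' = f x}"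
  have per: "permutation f" using f_perm fin permutation_permutes by blast
  from step have y: "y \<in> D" "(y, x) \<in> ?r\<^sup>*" and z: "z = e y \<or> z = f y" by auto
  have "(z, y) \<in> ?r\<^sup>*" using z
  proof
    assume "z = e y"
    then show ?thesis using e_e[OF y(1)] by auto
  next
    assume zf: "z = f y"
    have "(z, u) \<in> ?r\<^sup>*" if "u \<in> orbit f z" for u
      using that by induction (auto intro: rtrancl.rtrancl_into_rtrancl)
    moreover have "y \<in> orbit f z"
      using permutation_orbit_step[OF per, of y] permutation_self_in_orbit[OF per, of y] zf by simp
    ultimately show ?thesis by blast
  qed
  then show ?case using y z by auto
qed (use assms(2) in auto)

lemma component:
  fixes d0 :: 'd
  defines "X \<equiv> {x. (d0, x) \<in> {(x, x'). x' = e x \<or> x' = f x}\<^sup>*}"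
  assumes d0: "d0 \<in> D"
  shows "d0 \<in> X" and "X \<subseteq> D"
    and "combinatorial_map X (perm_restrict e X) (perm_restrict f X)"
    and "combinatorial_map.linked (perm_restrict e X) (perm_restrict f X) X"
proof -
  let ?r = "{(x, x'). x' = e x \<or> x' = f x}"
  let ?s = "{(x, x'). x' = perm_restrict e X x \<or> x' = perm_restrict f X x}"
  show d0X: "d0 \<in> X" by (simp add: X_def)
  show sub: "X \<subseteq> D" using linked_sym[OF _ d0] unfolding X_def by blast
  have cl: "e x \<in> X" "f x \<in> X" if "x \<in> X" for x
    using that unfolding X_def by (auto intro: rtrancl.rtrancl_into_rtrancl)
  have finX: "finite X" using sub fin finite_subset by blast
  have perm: "perm_restrict g X permutes X" if g: "g permutes D" and "\<And>x. x \<in> X \<Longrightarrow> g x \<in> X" for g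
  proof (rule bij_imp_permutes)
    have inj: "inj_on g X" using permutes_inj[OF g] inj_on_subset by blast
    then have "g ` X = X" using endo_inj_surj[OF finX] that(2) by blast
    then have "bij_betw g X X" using inj by (simp add: bij_betw_def)
    moreover have "bij_betw (perm_restrict g X) X X \<longleftrightarrow> bij_betw g X X"
      by (rule bij_betw_cong) (simp add: perm_restrict_def)
    ultimately show "bij_betw (perm_restrict g X) X X" by blast
  qed (simp add: perm_restrict_def)
  show cm: "combinatorial_map X (perm_restrict e X) (perm_restrict f X)"
    by unfold_locales
       (use finX perm[OF f_perm cl(2)] perm[OF e_perm cl(1)] e_neq e_e sub cl in \<open>auto simp: perm_restrict_def\<close>)
  interpret X: combinatorial_map X "perm_restrict e X" "perm_restrict f X" by (rule cm)
  have reach: "(d0, x) \<in> ?s\<^sup>*" if "x \<in> X" for x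
  proof -
    have "(d0, x) \<in> ?r\<^sup>*" using that by (simp add: X_def)
    then show ?thesis
    proof induction
      case (step y z)
      have "y \<in> X" using step(1) by (simp add: X_def)
      then have "(y, z) \<in> ?s" using step(2) by (auto simp: perm_restrict_def)
      then show ?case using step(3) by (rule rtrancl.rtrancl_into_rtrancl[rotated])
    qed simp
  qed
  show "X.linked X"
    unfolding X.linked_def
  proof (intro ballI)
    fix d d' assume "d \<in> X" "d' \<in> X"
    then have "(d, d0) \<in> ?s\<^sup>*" "(d0, d') \<in> ?s\<^sup>*"
      using X.linked_sym[OF reach d0X] reach by auto
    then show "(d, d') \<in> ?s\<^sup>*" by (rule rtrancl_trans)
  qed
qed

end


section \<open>Squeezing faces\<close>

text \<open>
  The faces outside \<open>R\<close> are squeezed: the involution \<open>\<rho>\<close> pairs each of their darts with a neighbour on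
  the same face, to which it is to be glued. The function \<open>sg\<close> stands for the direction of the edges;
  its purpose is to ensure that no kept dart gets glued to itself.
\<close>

locale face_squeezing = combinatorial_map +
  fixes R :: "'a set" and \<rho> :: "'a \<Rightarrow> 'a" and sg :: "'a \<Rightarrow> bool"
  assumes R_sub: "R \<subseteq> D"
    and f_R: "x \<in> R \<Longrightarrow> f x \<in> R"
    and \<rho>_fix: "x \<notin> D - R \<Longrightarrow> \<rho> x = x"
    and \<rho>_in: "x \<in> D - R \<Longrightarrow> \<rho> x \<in> D - R"
    and \<rho>_neq: "x \<in> D - R \<Longrightarrow> \<rho> x \<noteq> x"
    and \<rho>_\<rho>': "x \<in> D - R \<Longrightarrow> \<rho> (\<rho> x) = x"
    and \<rho>_adj: "x \<in> D - R \<Longrightarrow> \<rho> x = f x \<or> x = f (\<rho> x)"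
    and sg_e: "x \<in> D \<Longrightarrow> sg (e x) = (\<not> sg x)"
    and sg_\<rho>: "x \<in> D - R \<Longrightarrow> sg (\<rho> x) = (\<not> sg x)"
begin

lemma \<rho>_\<rho>: "\<rho> (\<rho> x) = x"
  using \<rho>_\<rho>' \<rho>_fix by (cases "x \<in> D - R") auto

lemma \<rho>_R: "\<rho> x \<in> R \<longleftrightarrow> x \<in> R"
  using \<rho>_fix \<rho>_in by (metis DiffD2)

lemma \<rho>_perm: "\<rho> permutes D"
proof (rule bij_imp_permutes)
  show "bij_betw \<rho> D D"
    by (rule bij_betw_byWitness[where f' = \<rho>]) (use \<rho>_\<rho> \<rho>_fix \<rho>_in R_sub in force)+
qed (use \<rho>_fix in auto)

text \<open>
  From a dart whose face has just been entered, cross this face by \<open>\<rho>\<close> if it is squeezed, and then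
  cross the edge. The dart \<open>reglue d\<close> is the first one in \<open>R\<close> on the trajectory of \<open>d\<close>.
\<close>

definition \<pi> :: "'a \<Rightarrow> 'a" where "\<pi> x = e (\<rho> x)"

lemma \<pi>_perm: "\<pi> permutes D"
  using permutes_compose[OF \<rho>_perm e_perm] by (simp add: \<pi>_def[abs_def] comp_def)

lemma \<pi>_in: "\<pi> x \<in> D \<longleftrightarrow> x \<in> D" by (rule permutes_in_image[OF \<pi>_perm])

lemma \<pi>_pow_in: "(\<pi> ^^ k) x \<in> D \<longleftrightarrow> x \<in> D" by (induction k) (simp_all add: \<pi>_in)

lemma \<pi>_permutation: "permutation \<pi>" using \<pi>_perm fin permutation_permutes by blast

definition return_time :: "'a \<Rightarrow> nat" where
  "return_time d = (LEAST k. 0 < k \<and> (\<pi> ^^ k) d \<in> R)"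

definition reglue :: "'a \<Rightarrow> 'a" where
  "reglue d = (if d \<in> R then (\<pi> ^^ return_time d) d else d)"

lemma return:
  assumes "d \<in> R"
  shows "0 < return_time d" and "reglue d \<in> R"
    and "0 < k \<Longrightarrow> k < return_time d \<Longrightarrow> (\<pi> ^^ k) d \<notin> R"
    and "0 < k \<Longrightarrow> (\<pi> ^^ k) d \<in> R \<Longrightarrow> return_time d \<le> k"
proof -
  have ex: "\<exists>k. 0 < k \<and> (\<pi> ^^ k) d \<in> R"
    using permutation_self[OF \<pi>_permutation, of d] assms by metis
  show "0 < return_time d" "reglue d \<in> R"
    using LeastI_ex[OF ex] assms by (auto simp: return_time_def reglue_def)
  show "0 < k \<Longrightarrow> k < return_time d \<Longrightarrow> (\<pi> ^^ k) d \<notin> R"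
    using not_less_Least unfolding return_time_def by blast
  show "0 < k \<Longrightarrow> (\<pi> ^^ k) d \<in> R \<Longrightarrow> return_time d \<le> k"
    unfolding return_time_def by (rule Least_le) blast
qed

text \<open>
  Since \<open>\<rho>\<close> and \<open>e\<close> are involutions, the trajectory of \<open>reglue d\<close> is that of \<open>d\<close> read backwards. This makes
  \<open>reglue\<close> an involution.
\<close>

lemma return_reversed:
  assumes d: "d \<in> R" and "i \<le> return_time d"
  shows "(\<pi> ^^ i) (reglue d) = \<rho> ((\<pi> ^^ (return_time d - i)) d)"
  using assms(2)
proof (induction i)
  case 0
  have "\<rho> (reglue d) = reglue d" using return(2)[OF d] \<rho>_fix by auto
  then show ?case using d by (simp add: reglue_def)
next
  case (Suc i)
  define j where "j = return_time d - Suc i"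
  have j: "return_time d - i = Suc j" using Suc.prems by (simp add: j_def)
  have inD: "\<rho> ((\<pi> ^^ j) d) \<in> D"
    using \<pi>_pow_in d R_sub permutes_in_image[OF \<rho>_perm] by blast
  have "(\<pi> ^^ Suc i) (reglue d) = \<pi> (\<rho> (\<pi> ((\<pi> ^^ j) d)))"
    using Suc by (simp add: j)
  also have "\<dots> = e (e (\<rho> ((\<pi> ^^ j) d)))" by (simp add: \<pi>_def \<rho>_\<rho>)
  also have "\<dots> = \<rho> ((\<pi> ^^ j) d)" by (rule e_e[OF inD])
  finally show ?case by (simp add: j_def)
qed

lemma reglue_reglue:
  assumes d: "d \<in> R"
  shows "reglue (reglue d) = d"
proof -
  note r = return(2)[OF d]
  have "return_time (reglue d) = return_time d"
    unfolding return_time_def[of "reglue d"]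
  proof (rule Least_equality)
    have "\<rho> d = d" using d \<rho>_fix by blast
    then show "0 < return_time d \<and> (\<pi> ^^ return_time d) (reglue d) \<in> R"
      using return_reversed[OF d, of "return_time d"] return(1)[OF d] d by simp
  next
    fix k assume k: "0 < k \<and> (\<pi> ^^ k) (reglue d) \<in> R"
    show "return_time d \<le> k"
    proof (rule ccontr)
      assume "\<not> return_time d \<le> k"
      then have lt: "k < return_time d" by simp
      then have "(\<pi> ^^ (return_time d - k)) d \<in> R"
        using return_reversed[OF d, of k] k \<rho>_R by simp
      then show False using return(3)[OF d, of "return_time d - k"] k lt by simp
    qed
  qed
  then show ?thesis
    using return_reversed[OF d, of "return_time d"] r d \<rho>_fix[of d] by (simp add: reglue_def[of "reglue d"])
qed

text \<open>
  A trajectory crosses one edge more than it crosses squeezed faces, so a quantity that changes by the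
  involution \<open>\<iota>\<close> at every crossing of either kind changes by \<open>\<iota>\<close> altogether. This is applied to signs, to
  letters, and to pairs of potential and cocycle.
\<close>

lemma reglue_equivariant:
  assumes d: "d \<in> R"
    and ge: "\<And>x. x \<in> D \<Longrightarrow> g (e x) = \<iota> (g x)"
    and g\<rho>: "\<And>x. x \<in> D - R \<Longrightarrow> g (\<rho> x) = \<iota> (g x)"
    and inv: "\<And>c. \<iota> (\<iota> c) = c"
  shows "g (reglue d) = \<iota> (g d)"
proof -
  have dD: "d \<in> D" using d R_sub by blast
  have "g ((\<pi> ^^ Suc i) d) = \<iota> (g d)" if "Suc i \<le> return_time d" for i
    using that
  proof (induction i)
    case 0
    have "\<rho> d = d" using d \<rho>_fix by blast
    then show ?case using ge[OF dD] by (simp add: \<pi>_def)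
  next
    case (Suc i)
    define z where "z = (\<pi> ^^ Suc i) d"
    have z: "z \<in> D - R" using return(3)[OF d, of "Suc i"] Suc.prems \<pi>_pow_in[of "Suc i" d] dD
      unfolding z_def by simp
    have "g (\<pi> z) = \<iota> (\<iota> (g z))"
      unfolding \<pi>_def using ge[of "\<rho> z"] g\<rho>[OF z] \<rho>_in[OF z] by simp
    then show ?case using Suc by (simp add: z_def inv)
  qed
  from this[of "return_time d - 1"] show ?thesis
    using return(1)[OF d] d by (simp add: reglue_def)
qed

lemma squeezed_map: "combinatorial_map R reglue (perm_restrict f R)"
proof
  show finR: "finite R" using R_sub fin finite_subset by blast
  have inj: "inj_on f R" using permutes_inj[OF f_perm] inj_on_subset by blast
  then have "f ` R = R" using endo_inj_surj[OF finR] f_R by blast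
  then have "bij_betw f R R" using inj by (simp add: bij_betw_def)
  moreover have "bij_betw (perm_restrict f R) R R \<longleftrightarrow> bij_betw f R R"
    by (rule bij_betw_cong) (simp add: perm_restrict_def)
  ultimately show "perm_restrict f R permutes R"
    by (intro bij_imp_permutes) (auto simp: perm_restrict_def)
  show "reglue permutes R"
  proof (rule bij_imp_permutes)
    show "bij_betw reglue R R"
      by (rule bij_betw_byWitness[where f' = reglue]) (use reglue_reglue return(2) in auto)
  qed (simp add: reglue_def)
  show "reglue d \<noteq> d" if "d \<in> R" for d
    using reglue_equivariant[OF that, of sg Not] sg_e sg_\<rho> by auto
  show "reglue (reglue d) = d" if "d \<in> R" for d by (rule reglue_reglue[OF that])
qed

text \<open>
  A cocycle \<open>\<beta>\<close> of a component \<open>X\<close> is extended to all darts by spreading its value at a dart of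
  \<open>X\<close> along the trajectory and by zero elsewhere. On squeezed faces the extension is a cocycle because
  it is \<open>\<rho>\<close>-invariant. A potential of it satisfies the potential equation for \<open>reglue\<close> because
  crossing a squeezed face from \<open>x\<close> to \<open>\<rho> x\<close> changes it as the edge of \<open>x\<close> does.
\<close>

lemma mod2_acyclic_squeezed:
  assumes ac: mod2_acyclic
    and X: "X \<subseteq> R" "combinatorial_map X (perm_restrict reglue X) (perm_restrict f X)"
  shows "combinatorial_map.mod2_acyclic X (perm_restrict reglue X) (perm_restrict f X)"
proof -
  interpret X: combinatorial_map X "perm_restrict reglue X" "perm_restrict f X" by (rule X(2))
  have XD: "X \<subseteq> D" using X(1) R_sub by blast
  have clX: "f x \<in> X" "reglue x \<in> X" if "x \<in> X" for x
    using that X.f_in[of x] X.e_in[of x] by (simp_all add: perm_restrict_def)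
  have orbX: "orbit (perm_restrict f X) d = orbit f d" "orbit f d \<subseteq> X" if d: "d \<in> X" for d
  proof -
    show eq: "orbit (perm_restrict f X) d = orbit f d"
      by (rule orbit_perm_restrict[OF d clX(1)])
    show "orbit f d \<subseteq> X" using X.face_subset[OF d] eq by simp
  qed
  show ?thesis
    unfolding X.mod2_acyclic_def
  proof (intro allI impI)
    fix \<beta> :: "'a \<Rightarrow> bit"
    assume b: "(\<forall>d\<in>X. \<beta> (perm_restrict reglue X d) = \<beta> d) \<and>
      (\<forall>d\<in>X. (\<Sum>x\<in>orbit (perm_restrict f X) d. \<beta> x) = 0)"
    have b1: "\<beta> (reglue d) = \<beta> d" if "d \<in> X" for d using b that by (simp add: perm_restrict_def)
    have b2: "(\<Sum>x\<in>orbit f d. \<beta> x) = 0" if "d \<in> X" for d using b that orbX(1) by simp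
    define Z where "Z = {z. \<exists>d\<in>X. \<beta> d = 1 \<and> z \<in> orbit \<pi> d}"
    define \<alpha> :: "'a \<Rightarrow> bit" where "\<alpha> z = (if z \<in> Z then 1 else 0)" for z
    note same = permutes_orbit_eq_iff[OF \<pi>_perm fin]
    \<comment> \<open>Returns to \<open>R\<close> are iterates of \<open>reglue\<close>, so the extension restricts to \<open>\<beta>\<close> on \<open>X\<close>.\<close>
    have returns: "(\<pi> ^^ k) d \<in> X \<and> \<beta> ((\<pi> ^^ k) d) = \<beta> d" if "d \<in> X" "(\<pi> ^^ k) d \<in> R" for k d
      using that
    proof (induction k arbitrary: d rule: less_induct)
      case (less k)
      show ?case
      proof (cases "k = 0")
        case False
        have dR: "d \<in> R" using less.prems X(1) by blast
        have le: "return_time d \<le> k" using return(4)[OF dR] False less.prems by simp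
        have pow: "(\<pi> ^^ k) d = (\<pi> ^^ (k - return_time d)) (reglue d)"
          using funpow_add[of "k - return_time d" "return_time d" \<pi>] le dR by (simp add: reglue_def)
        have "k - return_time d < k" using return(1)[OF dR] False by simp
        from less.IH[OF this clX(2)[OF less.prems(1)]] show ?thesis
          using less.prems pow b1 by simp
      qed (use less.prems in simp)
    qed
    have \<alpha>_R: "\<alpha> d = (if d \<in> X then \<beta> d else 0)" if d: "d \<in> R" for d
    proof -
      have "d \<in> Z \<longleftrightarrow> d \<in> X \<and> \<beta> d = 1"
      proof
        assume "d \<in> Z"
        then obtain d1 k where "d1 \<in> X" "\<beta> d1 = 1" "d = (\<pi> ^^ k) d1"
          unfolding Z_def orbit_altdef by blast
        then show "d \<in> X \<and> \<beta> d = 1" using returns d by metis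
      next
        assume "d \<in> X \<and> \<beta> d = 1"
        then show "d \<in> Z"
          unfolding Z_def using permutation_self_in_orbit[OF \<pi>_permutation] by blast
      qed
      then show ?thesis unfolding \<alpha>_def by (cases "\<beta> d") auto
    qed
    have \<pi>_orbit: "\<pi> z \<in> orbit \<pi> d \<longleftrightarrow> z \<in> orbit \<pi> d" for z d
      using same[of "\<pi> z" d] same[of z d] permutation_orbit_step[OF \<pi>_permutation, of z] by simp
    have Z_\<rho>: "\<rho> z \<in> Z" if z: "z \<in> Z" for z
    proof -
      obtain d k where d: "d \<in> X" "\<beta> d = 1" "z = (\<pi> ^^ k) d"
        using z unfolding Z_def orbit_altdef by blast
      have "\<rho> ((\<pi> ^^ k) d) \<in> orbit \<pi> d" for k
      proof (induction k)
        case 0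
        have "\<rho> d = d" using d(1) X(1) \<rho>_fix by blast
        then show ?case using permutation_self_in_orbit[OF \<pi>_permutation] by simp
      next
        case (Suc k)
        have "\<rho> ((\<pi> ^^ k) d) \<in> D"
          using \<pi>_pow_in d(1) XD permutes_in_image[OF \<rho>_perm] by blast
        then have "\<pi> (\<rho> ((\<pi> ^^ Suc k) d)) = \<rho> ((\<pi> ^^ k) d)"
          using e_e by (simp add: \<pi>_def \<rho>_\<rho>)
        then show ?case using Suc \<pi>_orbit by metis
      qed
      then show ?thesis unfolding Z_def using d by blast
    qed
    have \<alpha>_\<rho>: "\<alpha> (\<rho> z) = \<alpha> z" for z
      unfolding \<alpha>_def using Z_\<rho>[of z] Z_\<rho>[of "\<rho> z"] \<rho>_\<rho>[of z] by metis
    have \<alpha>_e: "\<alpha> (e z) = \<alpha> z" for z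
    proof -
      have "\<pi> x \<in> Z \<longleftrightarrow> x \<in> Z" for x unfolding Z_def using \<pi>_orbit by simp
      then have "\<alpha> (\<pi> (\<rho> z)) = \<alpha> (\<rho> z)" by (simp add: \<alpha>_def)
      then show ?thesis by (simp add: \<pi>_def \<rho>_\<rho> \<alpha>_\<rho>)
    qed
    have \<alpha>_face: "(\<Sum>x\<in>orbit f d. \<alpha> x) = 0" if d: "d \<in> D" for d
    proof -
      have per: "permutation f" using f_perm fin permutation_permutes by blast
      note self = permutation_self_in_orbit[OF per]
      note fsame = permutes_orbit_eq_iff[OF f_perm fin]
      show ?thesis
      proof (cases "d \<in> R")
        case True
        have orbR: "orbit f d \<subseteq> R"
        proof
          fix x assume "x \<in> orbit f d"
          then show "x \<in> R" by induction (use True f_R in auto)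
        qed
        show ?thesis
        proof (cases "d \<in> X")
          case True
          have "(\<Sum>x\<in>orbit f d. \<alpha> x) = (\<Sum>x\<in>orbit f d. \<beta> x)"
          proof (rule sum.cong[OF refl])
            fix x assume "x \<in> orbit f d"
            then have "x \<in> R" "x \<in> X" using orbR orbX(2)[OF True] by auto
            then show "\<alpha> x = \<beta> x" using \<alpha>_R by simp
          qed
          then show ?thesis using b2[OF True] by simp
        next
          case False
          have "x \<notin> X" if x: "x \<in> orbit f d" for x
          proof
            assume "x \<in> X"
            then have "orbit f x \<subseteq> X" using orbX(2) by blast
            moreover have "d \<in> orbit f x" using x fsame[of x d] self[of d] by simp
            ultimately show False using False by blast
          qed
          then have "\<alpha> x = 0" if "x \<in> orbit f d" for x
            using \<alpha>_R[of x] orbR that by (metis subsetD)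
          then show ?thesis by (intro sum.neutral) blast
        qed
      next
        case False
        have notR: "x \<in> D - R" if "x \<in> orbit f d" for x
        proof -
          have "d \<in> R" if "x \<in> R"
          proof -
            have "u \<in> R" if "u \<in> orbit f x" for u using that by induction (use \<open>x \<in> R\<close> f_R in auto)
            moreover have "d \<in> orbit f x" using \<open>x \<in> orbit f d\<close> fsame[of x d] self[of d] by simp
            ultimately show ?thesis by blast
          qed
          then show ?thesis using False that face_subset[OF d] by blast
        qed
        show ?thesis
        proof (rule sum_bit_involution[where s = \<rho>])
          show "finite (orbit f d)" using finite_orbit[OF self] .
          fix x assume x: "x \<in> orbit f d"
          show "\<rho> x \<noteq> x" "\<rho> (\<rho> x) = x" "\<alpha> (\<rho> x) = \<alpha> x"
            by (rule \<rho>_neq[OF notR[OF x]], rule \<rho>_\<rho>, rule \<alpha>_\<rho>)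
          show "\<rho> x \<in> orbit f d"
          proof -
            have "orbit f (\<rho> x) = orbit f x"
              using \<rho>_adj[OF notR[OF x]] permutation_orbit_step[OF per, of x]
                permutation_orbit_step[OF per, of "\<rho> x"] by metis
            then show ?thesis using x fsame self by metis
          qed
        qed
      qed
    qed
    obtain h :: "'a \<Rightarrow> bit" where h: "\<forall>d\<in>D. h (e d) = h d + \<alpha> d \<and> h (f d) = h (e d)"
    proof -
      have "(\<forall>d\<in>D. \<alpha> (e d) = \<alpha> d) \<and> (\<forall>d\<in>D. (\<Sum>x\<in>orbit f d. \<alpha> x) = 0)"
        using \<alpha>_e \<alpha>_face by blast
      from ac[unfolded mod2_acyclic_def, rule_format, OF this] show thesis using that by blast
    qed
    have h_reglue: "h (reglue d) = h d + \<alpha> d" if d: "d \<in> R" for d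
    proof -
      have "(h (reglue d), \<alpha> (reglue d)) = (\<lambda>(c, a). (c + a, a)) (h d, \<alpha> d)"
      proof (rule reglue_equivariant[OF d, where g = "\<lambda>x. (h x, \<alpha> x)"])
        show "(h (e x), \<alpha> (e x)) = (\<lambda>(c, a). (c + a, a)) (h x, \<alpha> x)" if "x \<in> D" for x
          using h that \<alpha>_e by simp
        show "(h (\<rho> x), \<alpha> (\<rho> x)) = (\<lambda>(c, a). (c + a, a)) (h x, \<alpha> x)" if x: "x \<in> D - R" for x
        proof -
          have "h (\<rho> x) = h x + \<alpha> x"
            using \<rho>_adj[OF x]
          proof
            assume "\<rho> x = f x"
            then show ?thesis using h x by auto
          next
            assume "x = f (\<rho> x)"
            then have "h x = h (\<rho> x) + \<alpha> (\<rho> x)" using h \<rho>_in[OF x] by (metis DiffD1)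
            then show ?thesis using \<alpha>_\<rho>[of x] by (cases "h x"; cases "h (\<rho> x)"; cases "\<alpha> x") simp_all
          qed
          then show ?thesis using \<alpha>_\<rho> by simp
        qed
        show "(\<lambda>(c, a). (c + a, a)) ((\<lambda>(c, a). (c + a, a)) p) = p" for p :: "bit \<times> bit"
          by (cases p; cases "fst p"; cases "snd p") simp_all
      qed
      then show ?thesis by simp
    qed
    have "\<forall>d\<in>X. h (perm_restrict reglue X d) = h d + \<beta> d \<and>
        h (perm_restrict f X d) = h (perm_restrict reglue X d)"
    proof
      fix d assume d: "d \<in> X"
      then have dR: "d \<in> R" and dD: "d \<in> D" using X(1) XD by auto
      have "h (reglue d) = h d + \<beta> d" using h_reglue[OF dR] \<alpha>_R[OF dR] d by simp
      moreover have "h (f d) = h d + \<beta> d" using h dD \<alpha>_R[OF dR] d by simp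
      ultimately show "h (perm_restrict reglue X d) = h d + \<beta> d \<and>
        h (perm_restrict f X d) = h (perm_restrict reglue X d)" using d by (simp add: perm_restrict_def)
    qed
    then show "\<exists>h. \<forall>d\<in>X. h (perm_restrict reglue X d) = h d + \<beta> d \<and>
        h (perm_restrict f X d) = h (perm_restrict reglue X d)" by blast
  qed
qed

end

section \<open>Spherical diagrams over LOT presentations\<close>

text \<open>
  In this form the property of being a sphere is preserved by squeezing faces, up to connectedness.
\<close>

lemma sphere_cell_structure_iff:
  "sphere_cell_structure C \<longleftrightarrow>
     combinatorial_map (darts C) (opp C) (nxt C) \<and> darts C \<noteq> {} \<and>
     combinatorial_map.linked (opp C) (nxt C) (darts C) \<and>
     combinatorial_map.mod2_acyclic (darts C) (opp C) (nxt C)"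
proof (cases "combinatorial_map (darts C) (opp C) (nxt C)")
  case True
  then interpret combinatorial_map "darts C" "opp C" "nxt C" .
  have edges: "diagram_edges C = orbit (opp C) ` darts C"
    unfolding diagram_edges_def using orbit_e by simp
  have euler: "int V - int E + int F = 2 \<longleftrightarrow> V + F = E + 2" for V E F by linarith
  show ?thesis
    unfolding sphere_cell_structure_def euler edges diagram_vertices_def diagram_faces_def
    using True fin f_perm e_perm e_neq e_e euler_char_2_iff_mod2_acyclic
    by (auto simp only: linked_def)
next
  case False
  then show ?thesis unfolding sphere_cell_structure_def combinatorial_map_def by blast
qed

lemma dart_letter_map:
  assumes "relator Q' (cell C d) = map (map_prod q id) (relator Q (cell C d))"
    and "pos C d < length (relator Q (cell C d))"
  shows "dart_letter Q' C d = map_prod q id (dart_letter Q C d)"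
  using assms by (simp add: dart_letter_def split: prod.splits)

lemma relator_LOT_presentation:
  "relator (LOT_presentation L) r =
    [(tail (lgraph L) r, True), (elabel L r, True), (head (lgraph L) r, False), (elabel L r, False)]"
  by (simp add: LOT_presentation_def Let_def)

lemma LOT_presentation_sel [simp]:
  "gens (LOT_presentation L) = verts (lgraph L)" "rels (LOT_presentation L) = arcs (lgraph L)"
  by (simp_all add: LOT_presentation_def)

definition collapse_map :: "('v, 'e) labeled_graph \<Rightarrow> 'v \<Rightarrow> 'v \<Rightarrow> 'v" where
  "collapse_map T y x = (if x \<in> verts (lgraph T) then y else x)"

lemma collapse_sel:
  "verts (lgraph (collapse L T y)) = collapse_map T y ` verts (lgraph L)"
  "arcs (lgraph (collapse L T y)) = arcs (lgraph L) - arcs (lgraph T)"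
  "tail (lgraph (collapse L T y)) = collapse_map T y \<circ> tail (lgraph L)"
  "head (lgraph (collapse L T y)) = collapse_map T y \<circ> head (lgraph L)"
  "elabel (collapse L T y) = collapse_map T y \<circ> elabel L"
  by (simp_all add: collapse_def collapse_map_def[abs_def] Let_def)

lemma relator_collapse:
  "relator (LOT_presentation (collapse L T y)) r =
    map (map_prod (collapse_map T y) id) (relator (LOT_presentation L) r)"
  by (simp add: relator_LOT_presentation collapse_sel)

lemma sub_LOT_gens:
  assumes "sub_LOT T L" "r \<in> arcs (lgraph T)"
  shows "fst ` set (relator (LOT_presentation L) r) \<subseteq> verts (lgraph T)"
proof -
  have "wf_digraph (lgraph T)" "compatible (lgraph L) (lgraph T)" "elabel T = elabel L"
    "elabel T ` arcs (lgraph T) \<subseteq> verts (lgraph T)"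
    using assms(1) by (auto simp: sub_LOT_def subgraph_def)
  then show ?thesis
    using assms(2) by (auto simp: relator_LOT_presentation compatible_def wf_digraph_def)
qed

lemma LOT_relator_gens:
  assumes "LOT L" "r \<in> arcs (lgraph L)"
  shows "fst ` set (relator (LOT_presentation L) r) \<subseteq> verts (lgraph L)"
proof -
  have "fin_digraph (lgraph L)" "elabel L ` arcs (lgraph L) \<subseteq> verts (lgraph L)"
    using assms(1) by (auto simp: LOT_def)
  moreover from this(1) have "wf_digraph (lgraph L)" by (simp add: fin_digraph_def)
  ultimately show ?thesis
    using assms(2) by (auto simp: relator_LOT_presentation wf_digraph_def)
qed

lemma collapse_relator_gens:
  assumes "LOT L" "r \<in> rels (LOT_presentation (collapse L T y))"
  shows "fst ` set (relator (LOT_presentation (collapse L T y)) r)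
    \<subseteq> gens (LOT_presentation (collapse L T y))"
proof -
  have "r \<in> arcs (lgraph L)" using assms(2) by (simp add: collapse_sel)
  from LOT_relator_gens[OF assms(1) this] show ?thesis
    by (force simp: relator_collapse collapse_sel)
qed

lemma spherical_diagram_length4:
  assumes C: "spherical_diagram Q C" and d: "d \<in> darts C"
    and len: "length (relator Q (cell C d)) = 4"
  shows "cell C d \<in> rels Q" "pos C d < 4" "cell C (nxt C d) = cell C d" "ori C (nxt C d) = ori C d"
    "pos C (nxt C d) = (if ori C d then pos C d + 1 else pos C d + 3) mod 4"
    "card (orbit (nxt C) d) = 4" "dart_letter Q C (opp C d) = oinv (dart_letter Q C d)"
proof -
  have "let n = length (relator Q (cell C d)) in
          cell C d \<in> rels Q \<and> pos C d < n \<and>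
          cell C (nxt C d) = cell C d \<and> ori C (nxt C d) = ori C d \<and>
          pos C (nxt C d) = (if ori C d then pos C d + 1 else pos C d + n - 1) mod n \<and>
          card (orbit (nxt C) d) = n \<and>
          dart_letter Q C (opp C d) = oinv (dart_letter Q C d)"
    using C d unfolding spherical_diagram_def by blast
  then show "cell C d \<in> rels Q" "pos C d < 4" "cell C (nxt C d) = cell C d" "ori C (nxt C d) = ori C d"
    "pos C (nxt C d) = (if ori C d then pos C d + 1 else pos C d + 3) mod 4"
    "card (orbit (nxt C) d) = 4" "dart_letter Q C (opp C d) = oinv (dart_letter Q C d)"
    unfolding len Let_def by (simp_all add: add.commute)
qed

lemma less_4_cases: "p < 4 \<Longrightarrow> p = 0 \<or> p = 1 \<or> p = 2 \<or> p = (3::nat)"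
  by linarith

text \<open>
  The exponents in a relator are \<open>1, 1, -1, -1\<close>.
\<close>

lemma snd_dart_letter_LOT_presentation:
  assumes "pos C d < 4"
  shows "snd (dart_letter (LOT_presentation L) C d) \<longleftrightarrow> (pos C d < 2) = ori C d"
  using less_4_cases[OF assms]
  by (cases "ori C d") (auto simp: dart_letter_def relator_LOT_presentation)

lemma oinv_oinv [simp]: "oinv (oinv x) = x"
  by (simp add: oinv_def)

lemma oinv_map: "map_prod q id (oinv x) = oinv (map_prod q id x)"
  by (simp add: oinv_def map_prod_def split: prod.splits)


section \<open>Collapsing a sub-LOT\<close>

text \<open>
  The 2-cells of the sub-LOT are squeezed, where \<open>\<rho>\<close> exchanges the positions 0 and 3 as well as 1 and 2 of a
  relator. The component of a dart with label outside \<open>S\<close> is a spherical diagram over the collapsed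
  presentation, and its folding edges with label different from \<open>y\<close> come from the given diagram.
\<close>

lemma DR_directed_away_from_collapse:
  fixes LP LT :: "('v, 'e) labeled_graph"
  assumes LOT: "LOT LP" and sub: "sub_LOT LT LP"
    and y: "y \<notin> verts (lgraph LP) - verts (lgraph LT)"
    and DR: "DR_directed_away_from (LOT_presentation (collapse LP LT y)) {y}"
  shows "DR_directed_away_from (LOT_presentation LP) (verts (lgraph LT))"
proof -
  define P where "P = LOT_presentation LP"
  define Pbar where "Pbar = LOT_presentation (collapse LP LT y)"
  define S where "S = verts (lgraph LT)"
  define q where "q = collapse_map LT y"
  have qS: "q x = y" if "x \<in> S" for x using that by (simp add: q_def S_def collapse_map_def)
  have q_not: "q x = x" if "x \<notin> S" for x using that by (simp add: q_def S_def collapse_map_def)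
  have rel: "relator Pbar r = map (map_prod q id) (relator P r)" for r
    unfolding Pbar_def P_def q_def by (rule relator_collapse)
  have len: "length (relator P r) = 4" "length (relator Pbar r) = 4" for r
    by (simp_all add: P_def Pbar_def relator_LOT_presentation)
  have gensPbar: "gens Pbar = q ` gens P" by (simp add: Pbar_def P_def q_def collapse_sel)
  have relsPbar: "rels Pbar = rels P - arcs (lgraph LT)" by (simp add: Pbar_def P_def collapse_sel)
  have S_sub: "S \<subseteq> gens P"
    using sub by (auto simp: S_def P_def sub_LOT_def subgraph_def)
  have rel_gens: "fst ` set (relator P r) \<subseteq> gens P" if "r \<in> rels P" for r
    using LOT_relator_gens[OF LOT] that by (simp add: P_def)
  have proper: "S \<subset> gens P"
  proof -
    have "S \<noteq> gens P"
    proof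
      assume "S = gens P"
      then have "gens Pbar \<subseteq> {y}" using gensPbar qS by auto
      then show False using DR by (auto simp: DR_directed_away_from_def Pbar_def)
    qed
    then show ?thesis using S_sub by blast
  qed
  have "\<exists>d\<in>darts C. folding_edge C d \<and> edge_label P C d \<notin> S"
    if C: "spherical_diagram P C" and d0: "d0 \<in> darts C" "edge_label P C d0 \<notin> S"
    for C :: "(nat, 'e) diagram" and d0
  proof -
    define D where "D = darts C"
    define e where "e = opp C"
    define f where "f = nxt C"
    have "sphere_cell_structure C" using C by (simp add: spherical_diagram_def)
    then have cm: "combinatorial_map D e f" and linked: "combinatorial_map.linked e f D"
      and acyclic: "combinatorial_map.mod2_acyclic D e f"
      by (auto simp: sphere_cell_structure_iff D_def e_def f_def)
    interpret combinatorial_map D e f by (rule cm)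
    note sd = spherical_diagram_length4[OF C _ len(1), folded D_def e_def f_def]
    define L where "L = dart_letter Pbar C"
    have L: "L d = map_prod q id (dart_letter P C d)" if "d \<in> D" for d
      unfolding L_def by (rule dart_letter_map[OF rel]) (use sd(2)[OF that] len in simp)
    have L_opp: "L (e d) = oinv (L d)" if "d \<in> D" for d
      using L[OF that] L[of "e d"] sd(7)[OF that] that by (simp add: oinv_map)
    have fst_L: "fst (L d) = q (edge_label P C d)" if "d \<in> D" for d
      using L[OF that] by (simp add: edge_label_def)
    define R where "R = {d \<in> D. cell C d \<notin> arcs (lgraph LT)}"
    have label_in: "edge_label P C d \<in> fst ` set (relator P (cell C d))" if "d \<in> D" for d
    proof -
      have "relator P (cell C d) ! pos C d \<in> set (relator P (cell C d))"
        using sd(2)[OF that] len by simp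
      then show ?thesis by (force simp: edge_label_def dart_letter_def split: prod.splits)
    qed
    have fst_L_T: "fst (L d) = y" if "d \<in> D - R" for d
    proof -
      have "cell C d \<in> arcs (lgraph LT)" using that by (auto simp: R_def)
      then have "edge_label P C d \<in> S"
        using label_in[of d] sub_LOT_gens[OF sub, of "cell C d"] that by (auto simp: S_def P_def)
      then show ?thesis using fst_L[of d] qS that by auto
    qed
    \<comment> \<open>Along a 2-cell the positions increase iff the orientation is preserved, so the partner of a dart,
      at position 3 minus its own, is its successor or its predecessor according to parity.\<close>
    define \<rho> where "\<rho> d = (if d \<in> D - R then if ori C d = odd (pos C d) then f d else inv f d else d)" for d
    have invf: "inv f d \<in> D" "f (inv f d) = d" if "d \<in> D" for d
      using that permutes_inverses(1)[OF f_perm] f_in[of "inv f d"] by auto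
    have inv_f: "inv f (f d) = d" for d using permutes_inverses(2)[OF f_perm] .
    have parity: "odd (pos C (f d)) = even (pos C d)" if "d \<in> D" for d
    proof -
      show ?thesis using less_4_cases[OF sd(2)[OF that]] unfolding sd(5)[OF that] by auto
    qed
    have fR: "f d \<in> R \<longleftrightarrow> d \<in> R" if "d \<in> D" for d
      using that sd(3)[OF that] by (simp add: R_def)
    have \<rho>_props: "\<rho> d \<in> D - R \<and> \<rho> d \<noteq> d \<and> \<rho> (\<rho> d) = d \<and> (\<rho> d = f d \<or> d = f (\<rho> d)) \<and> L (\<rho> d) = oinv (L d)"
      if d: "d \<in> D - R" for d
    proof -
      have snd_L: "snd (L x) = ((pos C x < 2) = ori C x)" if "x \<in> D" for x
        unfolding L_def Pbar_def by (rule snd_dart_letter_LOT_presentation[OF sd(2)[OF that]])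
      have step: "\<rho> x = f x" "\<rho> (f x) = x" "f x \<noteq> x" "L (f x) = oinv (L x)"
        if x: "x \<in> D - R" "ori C x = odd (pos C x)" for x
      proof -
        have xD: "x \<in> D" using x(1) by blast
        have fx: "f x \<in> D - R" using x(1) fR[OF xD] f_in[of x] by blast
        show "\<rho> x = f x" using x by (simp add: \<rho>_def)
        have "\<not> (ori C (f x) = odd (pos C (f x)))"
          unfolding parity[OF xD] sd(4)[OF xD] using x(2) by blast
        then show "\<rho> (f x) = x" using fx by (simp add: \<rho>_def inv_f)
        show "f x \<noteq> x" using parity[OF xD] by metis
        have "snd (L (f x)) = (\<not> snd (L x))"
        proof -
          show ?thesis
            using less_4_cases[OF sd(2)[OF xD]] snd_L[OF xD] snd_L[of "f x"] xD sd(4,5)[OF xD] x(2) by auto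
        qed
        then show "L (f x) = oinv (L x)"
          using fst_L_T[OF x(1)] fst_L_T[OF fx] by (simp add: oinv_def prod_eq_iff)
      qed
      show ?thesis
      proof (cases "ori C d = odd (pos C d)")
        case True
        then show ?thesis using step[OF d True] fR[of d] d by auto
      next
        case False
        define u where "u = inv f d"
        have dD: "d \<in> D" using d by simp
        have u: "u \<in> D" "f u = d" using invf[OF dD] by (auto simp: u_def)
        have uR: "u \<in> D - R" using fR[OF u(1)] u d by simp
        have ou: "ori C u = odd (pos C u)"
          using False sd(4)[OF u(1)] parity[OF u(1)] u(2) by auto
        have "\<rho> d = u" using False d by (simp add: \<rho>_def u_def)
        moreover have "L u = oinv (L d)" using step(4)[OF uR ou] u(2) by simp
        ultimately show ?thesis using step[OF uR ou] u uR by auto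
      qed
    qed
    interpret sq: face_squeezing D e f R \<rho> "snd \<circ> L"
    proof unfold_locales
      show "R \<subseteq> D" by (auto simp: R_def)
      show "f x \<in> R" if "x \<in> R" for x using that fR[of x] by (auto simp: R_def)
      show "\<rho> x = x" if "x \<notin> D - R" for x using that by (auto simp: \<rho>_def)
      show "(snd \<circ> L) (e x) = (\<not> (snd \<circ> L) x)" if "x \<in> D" for x
        using L_opp[OF that] by (simp add: oinv_def)
      show "(snd \<circ> L) (\<rho> x) = (\<not> (snd \<circ> L) x)" if "x \<in> D - R" for x
        using \<rho>_props[OF that] by (simp add: oinv_def)
    qed (use \<rho>_props in blast)+
    have not_S_R: "d \<in> R" if "d \<in> D" "edge_label P C d \<notin> S" for d
      using that label_in[of d] sub_LOT_gens[OF sub, of "cell C d"] by (auto simp: R_def S_def P_def)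
    have d0R: "d0 \<in> R" using not_S_R d0 by (simp add: D_def)
    interpret sm: combinatorial_map R sq.reglue "perm_restrict f R" by (rule sq.squeezed_map)
    define X where "X = {x. (d0, x) \<in> {(x, x'). x' = sq.reglue x \<or> x' = perm_restrict f R x}\<^sup>*}"
    note comp = sm.component[OF d0R, folded X_def]
    have restr: "perm_restrict (perm_restrict f R) X = perm_restrict f X"
      using comp(2) by (simp add: perm_restrict_perm_restrict Int_absorb1)
    note comp = comp[unfolded restr]
    define C' where "C' = \<lparr>darts = X, opp = perm_restrict sq.reglue X, nxt = perm_restrict f X,
      cell = cell C, pos = pos C, ori = ori C\<rparr>"
    have C'_sel: "darts C' = X" "opp C' = perm_restrict sq.reglue X" "nxt C' = perm_restrict f X"
      "cell C' = cell C" "pos C' = pos C" "ori C' = ori C" by (simp_all add: C'_def)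
    have letter: "dart_letter Pbar C' = L"
      by (simp add: L_def dart_letter_def[abs_def] C'_sel)
    interpret X: combinatorial_map X "perm_restrict sq.reglue X" "perm_restrict f X" by (rule comp(3))
    have XR: "d \<in> R" and XD: "d \<in> D" if "d \<in> X" for d using that comp(2) by (auto simp: R_def)
    have clX: "f d \<in> X" if "d \<in> X" for d
      using that X.f_in[of d] by (simp add: perm_restrict_def)
    have sphere': "sphere_cell_structure C'"
      unfolding sphere_cell_structure_iff C'_sel
      using comp sq.mod2_acyclic_squeezed[OF acyclic comp(2,3)] by blast
    have diag': "spherical_diagram Pbar C'"
      unfolding spherical_diagram_def
    proof (intro conjI ballI sphere')
      fix d assume "d \<in> darts C'"
      then have d: "d \<in> X" by (simp add: C'_sel)
      note s = sd[OF XD[OF d]]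
      have "L (sq.reglue d) = oinv (L d)"
        by (rule sq.reglue_equivariant[OF XR[OF d]]) (use L_opp \<rho>_props in auto)
      moreover have "cell C d \<in> rels Pbar" using XR[OF d] s(1) relsPbar by (auto simp: R_def)
      moreover have "orbit (perm_restrict f X) d = orbit f d"
        by (rule orbit_perm_restrict[OF d clX])
      ultimately show "let n = length (relator Pbar (cell C' d)) in
          cell C' d \<in> rels Pbar \<and> pos C' d < n \<and>
          cell C' (nxt C' d) = cell C' d \<and> ori C' (nxt C' d) = ori C' d \<and>
          pos C' (nxt C' d) = (if ori C' d then pos C' d + 1 else pos C' d + n - 1) mod n \<and>
          card (orbit (nxt C') d) = n \<and> dart_letter Pbar C' (opp C' d) = oinv (dart_letter Pbar C' d)"
        using s d by (simp add: Let_def len letter C'_sel perm_restrict_def add.commute)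
    qed
    have label: "edge_label Pbar C' d = q (edge_label P C d)" if "d \<in> D" for d
      using fst_L[OF that] by (simp add: edge_label_def letter)
    have "edge_label Pbar C' d0 \<noteq> y"
    proof -
      have d0D: "d0 \<in> D" using d0 by (simp add: D_def)
      have "edge_label P C d0 \<in> gens P - S"
        using label_in[OF d0D] rel_gens[OF sd(1)[OF d0D]] d0 by auto
      then show ?thesis using y label[OF d0D] q_not by (auto simp: P_def S_def)
    qed
    then have "\<exists>d\<in>darts C'. edge_label Pbar C' d \<notin> {y}" using comp(1) C'_sel(1) by blast
    then have "\<exists>d\<in>darts C'. folding_edge C' d \<and> edge_label Pbar C' d \<notin> {y}"
      using DR diag' unfolding DR_directed_away_from_def Pbar_def[symmetric] by blast
    then obtain d where d: "d \<in> X" and fold: "folding_edge C' d" and ly: "edge_label Pbar C' d \<noteq> y"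
      unfolding C'_sel by blast
    have dD: "d \<in> D" and dR: "d \<in> R" using XD[OF d] XR[OF d] .
    have notS: "edge_label P C d \<notin> S" using ly label[OF dD] qS by metis
    have "fst (L (e d)) = fst (L d)" using L_opp[OF dD] by (simp add: oinv_def)
    then have "fst (L (e d)) \<noteq> y" using ly by (simp add: edge_label_def letter)
    then have eR: "e d \<in> R" using fst_L_T[of "e d"] dD by auto
    \<comment> \<open>Both sides of the edge of \<open>d\<close> are kept, so this edge was not reglued.\<close>
    have \<pi>d: "sq.\<pi> d = e d" using dR sq.\<rho>_fix by (simp add: sq.\<pi>_def)
    have "sq.return_time d = 1" using sq.return(1)[OF dR] sq.return(4)[OF dR, of 1] eR \<pi>d by simp
    then have "sq.reglue d = e d" using dR \<pi>d by (simp add: sq.reglue_def)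
    then have "folding_edge C d"
      using fold d by (simp add: folding_edge_def C'_sel perm_restrict_def e_def)
    then show ?thesis using notS dD by (auto simp: D_def)
  qed
  then show ?thesis
    using proper unfolding DR_directed_away_from_def P_def S_def by blast
qed

section \<open>Closed walks and reduced cycles\<close>

lemma oinv_neq: "oinv x \<noteq> x"
  by (simp add: oinv_def prod_eq_iff)

lemma oend_oinv [simp]: "oend G (oinv x) = ostart G x" "ostart G (oinv x) = oend G x"
  by (simp_all add: oinv_def oend_def ostart_def)

text \<open>
  A closed walk that has no backtracks, except possibly at its base point, becomes cyclically reduced
  if inverse first and last edges are removed as long as possible. Not everything is removed, since
  the last two edges would form a backtrack.
\<close>

lemma reduced_closed_walk_contains_reduced_cycle:
  assumes "p \<noteq> []" "fst ` set p \<subseteq> arcs G"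
    and "successively (\<lambda>x z. oend G x = ostart G z \<and> z \<noteq> oinv x) p"
    and "oend G (last p) = ostart G (hd p)"
  shows "\<exists>c. reduced_cycle G c \<and> length c \<le> length p \<and> set c \<subseteq> set p"
  using assms
proof (induction p rule: length_induct)
  case (1 p)
  show ?case
  proof (cases "hd p = oinv (last p)")
    case False
    have "oend G (p ! i) = ostart G (p ! (Suc i mod length p)) \<and> p ! (Suc i mod length p) \<noteq> oinv (p ! i)"
      if i: "i < length p" for i
    proof (cases "Suc i = length p")
      case True
      then have "p ! i = last p" "p ! (Suc i mod length p) = hd p"
        using "1.prems"(1) by (simp_all add: last_conv_nth hd_conv_nth flip: True)
      then show ?thesis using False "1.prems"(4) by simp
    next
      case False
      then show ?thesis
        using i "1.prems"(3) by (auto simp: successively_conv_nth)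
    qed
    then have "reduced_cycle G p"
      using "1.prems" by (simp add: reduced_cycle_def closed_edge_path_def)
    then show ?thesis by blast
  next
    case True
    obtain x p' where p': "p = x # p'" using "1.prems"(1) by (cases p) auto
    have "p' \<noteq> []" using True oinv_neq[of x] by (auto simp: p')
    then obtain m z where m: "p' = m @ [z]" by (cases p' rule: rev_cases) auto
    have x: "x = oinv z" using True by (simp add: p' m)
    have "m \<noteq> []" using "1.prems"(3) x by (auto simp: p' m)
    then have succ: "successively (\<lambda>x z. oend G x = ostart G z \<and> z \<noteq> oinv x) m"
      and ends: "oend G x = ostart G (hd m)" "oend G (last m) = ostart G z"
      using "1.prems"(3) by (auto simp: p' m successively_append_iff successively_Cons)
    have "oend G (last m) = ostart G (hd m)" using ends by (simp add: x)
    then have "\<exists>c. reduced_cycle G c \<and> length c \<le> length m \<and> set c \<subseteq> set m"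
      using "1.IH"[rule_format, of m] \<open>m \<noteq> []\<close> succ "1.prems"(2) by (simp add: p' m)
    then show ?thesis by (fastforce simp: p' m)
  qed
qed

text \<open>
  The part of the path between two consecutive visits to \<open>w\<close> is a closed walk without backtracks in
  its interior. The path is given as a periodic sequence, so that it can be cut at any place.
\<close>

lemma closed_path_backtracking_at_one_vertex:
  fixes g :: "nat \<Rightarrow> 'e oedge"
  assumes n: "0 < n" and period: "\<And>j. g (j + n) = g j"
    and arcs: "\<And>j. fst (g j) \<in> arcs G"
    and path: "\<And>j. oend G (g j) = ostart G (g (Suc j))"
    and backtrack: "\<And>j. g (Suc j) = oinv (g j) \<Longrightarrow> oend G (g j) = w"
  shows "\<exists>c. reduced_cycle G c \<and> length c \<le> n \<and> set c \<subseteq> range g"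
proof -
  have walk: "\<exists>c. reduced_cycle G c \<and> length c \<le> n \<and> set c \<subseteq> range g"
    if k: "0 < k" "k \<le> n" and closed: "ostart G (g (j0 + k)) = ostart G (g j0)"
      and noback: "\<And>j. j0 \<le> j \<Longrightarrow> Suc j < j0 + k \<Longrightarrow> g (Suc j) \<noteq> oinv (g j)" for j0 k
  proof -
    let ?p = "map g [j0..<j0 + k]"
    have "\<exists>c. reduced_cycle G c \<and> length c \<le> length ?p \<and> set c \<subseteq> set ?p"
    proof (rule reduced_closed_walk_contains_reduced_cycle)
      show "?p \<noteq> []" using k by simp
      show "fst ` set ?p \<subseteq> arcs G" using arcs by auto
      show "successively (\<lambda>x z. oend G x = ostart G z \<and> z \<noteq> oinv x) ?p"
        using path noback by (auto simp: successively_conv_nth)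
      have "last ?p = g (j0 + k - 1)" "hd ?p = g j0"
        using k by (simp_all add: last_map last_upt hd_map)
      then show "oend G (last ?p) = ostart G (hd ?p)"
        using path[of "j0 + k - 1"] closed k by simp
    qed
    then obtain c where "reduced_cycle G c" "length c \<le> length ?p" "set c \<subseteq> set ?p" by blast
    moreover have "length ?p \<le> n" "set ?p \<subseteq> range g" using k by auto
    ultimately show ?thesis by (meson order_trans)
  qed
  show ?thesis
  proof (cases "\<exists>j. g (Suc j) = oinv (g j)")
    case False
    then show ?thesis using walk[of n 0] n period[of 0] by simp
  next
    case True
    then obtain i where "g (Suc i) = oinv (g i)" by blast
    then have w: "ostart G (g (Suc i)) = w" using backtrack path by metis
    let ?Q = "\<lambda>k. 0 < k \<and> ostart G (g (Suc i + k)) = w"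
    define k where "k = (LEAST k. ?Q k)"
    have Qn: "?Q n" using n w period[of "Suc i"] by simp
    have Qk: "?Q k" unfolding k_def by (rule LeastI[of ?Q, OF Qn])
    have kn: "k \<le> n" unfolding k_def by (rule Least_le[of ?Q, OF Qn])
    show ?thesis
    proof (rule walk[of k "Suc i"])
      show "0 < k" using Qk by blast
      show "k \<le> n" by (rule kn)
      show "ostart G (g (Suc i + k)) = ostart G (g (Suc i))" using Qk w by simp
      fix j assume j: "Suc i \<le> j" "Suc j < Suc i + k"
      show "g (Suc j) \<noteq> oinv (g j)"
      proof
        assume "g (Suc j) = oinv (g j)"
        then have "ostart G (g (Suc i + (Suc j - Suc i))) = w"
          using backtrack path[of j] j(1) by simp
        moreover have "Suc j - Suc i < k" "0 < Suc j - Suc i" using j by linarith+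
        ultimately show False using not_less_Least[of "Suc j - Suc i" ?Q, folded k_def] by blast
      qed
    qed
  qed
qed


section \<open>Height functions and vertices of constant sign\<close>

lemma bit_of_int_eq_0_iff: "(of_int z :: bit) = 0 \<longleftrightarrow> even z"
proof (cases "even z")
  case True
  then obtain m where "z = 2 * m" by (rule evenE)
  then show ?thesis by simp
next
  case False
  then obtain m where "z = 2 * m + 1" by (rule oddE)
  then have "(of_int z :: bit) = 1" by (simp only: of_int_add of_int_mult) simp
  then show ?thesis using False by simp
qed

context combinatorial_map begin

text \<open>
  Reduce the integral cocycle \<open>\<alpha>\<close> modulo 2 and lift a potential of the reduction to an integral
  function. The difference of \<open>\<alpha>\<close> and the coboundary of this function is an even cocycle; half of it is
  treated in the same way. This gives the binary digits of a potential one after another.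
\<close>

lemma integral_potential_mod_power_2:
  fixes \<alpha> :: "'d \<Rightarrow> int"
  assumes ac: mod2_acyclic
    and anti: "\<And>d. d \<in> D \<Longrightarrow> \<alpha> (e d) = - \<alpha> d"
    and face: "\<And>d. d \<in> D \<Longrightarrow> (\<Sum>x\<in>orbit f d. \<alpha> x) = 0"
  shows "\<exists>h :: 'd \<Rightarrow> int. \<forall>d\<in>D. h (f d) = h (e d) \<and> 2 ^ k dvd h (e d) - h d - \<alpha> d"
  using anti face
proof (induction k arbitrary: \<alpha>)
  case 0
  show ?case by (rule exI[of _ "\<lambda>_. 0"]) simp
next
  case (Suc k)
  define \<beta> :: "'d \<Rightarrow> bit" where "\<beta> d = of_int (\<alpha> d)" for d
  have "\<beta> (e d) = \<beta> d" if "d \<in> D" for d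
    using Suc.prems(1)[OF that] by (simp add: \<beta>_def)
  moreover have "(\<Sum>x\<in>orbit f d. \<beta> x) = 0" if "d \<in> D" for d
  proof -
    have "(\<Sum>x\<in>orbit f d. \<beta> x) = of_int (\<Sum>x\<in>orbit f d. \<alpha> x)"
      unfolding \<beta>_def by (rule of_int_sum[symmetric])
    then show ?thesis using Suc.prems(2)[OF that] by simp
  qed
  ultimately have "(\<forall>d\<in>D. \<beta> (e d) = \<beta> d) \<and> (\<forall>d\<in>D. (\<Sum>x\<in>orbit f d. \<beta> x) = 0)" by blast
  from ac[unfolded mod2_acyclic_def, rule_format, OF this]
  obtain hb :: "'d \<Rightarrow> bit" where hb: "\<forall>d\<in>D. hb (e d) = hb d + \<beta> d \<and> hb (f d) = hb (e d)" by blast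
  define hi :: "'d \<Rightarrow> int" where "hi d = (if hb d = 1 then 1 else 0)" for d
  have hi: "of_int (hi d) = hb d" for d by (cases "hb d") (simp_all add: hi_def)
  have hi_f: "hi (f d) = hi (e d)" if "d \<in> D" for d using hb that by (simp add: hi_def)
  define \<gamma> where "\<gamma> d = (\<alpha> d - (hi (e d) - hi d)) div 2" for d
  have \<gamma>: "2 * \<gamma> d = \<alpha> d - (hi (e d) - hi d)" if d: "d \<in> D" for d
  proof -
    have "(of_int (\<alpha> d - (hi (e d) - hi d)) :: bit) = \<beta> d - (hb (e d) - hb d)"
      by (simp only: of_int_diff hi \<beta>_def)
    also have "\<dots> = 0"
      using hb d by (cases "\<beta> d"; cases "hb d") simp_all
    finally have "even (\<alpha> d - (hi (e d) - hi d))" by (simp only: bit_of_int_eq_0_iff)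
    then show ?thesis unfolding \<gamma>_def by (rule dvd_mult_div_cancel)
  qed
  have g1: "\<gamma> (e d) = - \<gamma> d" if d: "d \<in> D" for d
    using \<gamma>[OF d] \<gamma>[of "e d"] d e_e[OF d] Suc.prems(1)[OF d] by simp
  have g2: "(\<Sum>x\<in>orbit f d. \<gamma> x) = 0" if d: "d \<in> D" for d
  proof -
    have "2 * (\<Sum>x\<in>orbit f d. \<gamma> x) = (\<Sum>x\<in>orbit f d. \<alpha> x - (hi (f x) - hi x))"
      unfolding sum_distrib_left
    proof (rule sum.cong[OF refl])
      fix x assume "x \<in> orbit f d"
      then have "x \<in> D" using face_subset[OF d] by blast
      then show "2 * \<gamma> x = \<alpha> x - (hi (f x) - hi x)" using \<gamma> hi_f by simp
    qed
    also have "\<dots> = 0"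
      using Suc.prems(2)[OF d] sum_orbit_shift[OF f_perm fin, of hi d] by (simp add: sum_subtractf)
    finally show ?thesis by simp
  qed
  obtain h1 :: "'d \<Rightarrow> int" where h1: "\<forall>d\<in>D. h1 (f d) = h1 (e d) \<and> 2 ^ k dvd h1 (e d) - h1 d - \<gamma> d"
    using Suc.IH[OF g1 g2] by blast
  show ?case
  proof (intro exI[of _ "\<lambda>d. hi d + 2 * h1 d"] ballI conjI)
    fix d assume d: "d \<in> D"
    show "hi (f d) + 2 * h1 (f d) = hi (e d) + 2 * h1 (e d)" using hi_f[OF d] h1 d by simp
    have "hi (e d) + 2 * h1 (e d) - (hi d + 2 * h1 d) - \<alpha> d = 2 * (h1 (e d) - h1 d - \<gamma> d)"
      using \<gamma>[OF d] by (simp add: algebra_simps)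
    moreover have "2 * 2 ^ k dvd 2 * (h1 (e d) - h1 d - \<gamma> d)" using h1 d by (intro mult_dvd_mono) auto
    ultimately show "2 ^ Suc k dvd hi (e d) + 2 * h1 (e d) - (hi d + 2 * h1 d) - \<alpha> d"
      by (simp only: power_Suc)
  qed
qed

text \<open>
  Otherwise each vertex can be left by a dart of the sign opposite to \<open>s\<close>. Following such darts leads to a
  cycle along which a height function would change by its length. Already a height function modulo
  a power of 2 that exceeds this length gives a contradiction.
\<close>

lemma exists_vertex_of_constant_sign:
  fixes sg :: "'d \<Rightarrow> bool"
  assumes ac: mod2_acyclic and ne: "D \<noteq> {}"
    and anti: "\<And>d. d \<in> D \<Longrightarrow> sg (e d) = (\<not> sg d)"
    and face: "\<And>d. d \<in> D \<Longrightarrow> (\<Sum>x\<in>orbit f d. if sg x then 1 else - 1 :: int) = 0"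
  shows "\<exists>d\<in>D. \<forall>x\<in>orbit (f \<circ> e) d. sg x = s"
proof (rule ccontr)
  assume "\<not> ?thesis"
  then have "\<forall>d\<in>D. \<exists>x\<in>orbit (f \<circ> e) d. sg x = (\<not> s)" by blast
  then obtain c where c: "\<And>d. d \<in> D \<Longrightarrow> c d \<in> orbit (f \<circ> e) d \<and> sg (c d) = (\<not> s)" by metis
  have cD: "c d \<in> D" if "d \<in> D" for d
    using c[OF that] permutes_orbit_subset[OF v_perm that] by blast
  obtain d0 where d0: "d0 \<in> D" using ne by blast
  define x where "x i = ((\<lambda>z. c (e z)) ^^ i) (c d0)" for i
  have x_Suc: "x (Suc i) = c (e (x i))" for i by (simp add: x_def)
  have xD: "x i \<in> D" for i by (induction i) (simp_all add: x_def cD d0)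
  have x_sg: "sg (x i) = (\<not> s)" for i
    by (cases i) (use c[OF d0] c[of "e (x (i - 1))"] xD[of "i - 1"] x_Suc[of "i - 1"] in \<open>auto simp: x_def\<close>)
  \<comment> \<open>the change of height along each dart of the walk\<close>
  define t :: int where "t = (if s then - 1 else 1)"
  have "\<not> inj x"
  proof
    assume "inj x"
    then have "infinite (range x)" by (rule range_inj_infinite)
    then show False using xD fin finite_subset[of "range x" D] by blast
  qed
  then obtain i j where ij: "i < j" "x i = x j"
    by (metis injI linorder_neqE_nat)
  obtain h :: "'d \<Rightarrow> int" where
    h: "\<forall>d\<in>D. h (f d) = h (e d) \<and> 2 ^ j dvd h (e d) - h d - (if sg d then 1 else - 1)"
  proof -
    have "(if sg (e d) then 1 else - 1 :: int) = - (if sg d then 1 else - 1)" if "d \<in> D" for d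
      using anti[OF that] by simp
    from integral_potential_mod_power_2[OF ac, of "\<lambda>d. if sg d then 1 else - 1", OF this face]
    show thesis using that by blast
  qed
  have h_orbit: "h z = h d" if "d \<in> D" "z \<in> orbit (f \<circ> e) d" for d z
    using that(2)
  proof induction
    case base
    then show ?case using h e_e[OF that(1)] that(1) by simp
  next
    case (step z)
    then have "z \<in> D" using permutes_orbit_subset[OF v_perm that(1)] by blast
    then show ?case using step.IH h e_e by simp
  qed
  have walk: "2 ^ j dvd h (x (i + m)) - h (x i) - int m * t" for m
  proof (induction m)
    case (Suc m)
    have "h (x (i + Suc m)) = h (e (x (i + m)))"
      using h_orbit[of "e (x (i + m))"] c xD x_Suc by simp
    moreover have "2 ^ j dvd h (e (x (i + m))) - h (x (i + m)) - t"
      using h xD[of "i + m"] x_sg[of "i + m"] by (auto simp: t_def)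
    ultimately have "2 ^ j dvd (h (x (i + m)) - h (x i) - int m * t) + (h (x (i + Suc m)) - h (x (i + m)) - t)"
      using Suc by (intro dvd_add) simp_all
    then show ?case by (simp add: algebra_simps)
  qed simp
  have "2 ^ j dvd int (j - i) * t" using walk[of "j - i"] ij by simp
  then have "2 ^ j dvd int (j - i)" by (auto simp: t_def split: if_splits)
  then have "2 ^ j \<le> int (j - i)" using ij(1) by (intro zdvd_imp_le) simp_all
  also have "\<dots> \<le> int j" by simp
  also have "int j < 2 ^ j" using of_nat_less_two_power[of j] by simp
  finally show False by simp
qed

end


section \<open>Vertex links as closed paths in the Whitehead graph\<close>

text \<open>
  The corner between the dart \<open>d\<close> and the next dart \<open>nxt C (opp C d)\<close> with the same start. It lies in the
  2-cell to the left of \<open>opp C d\<close>. If this 2-cell is mapped with reversed orientation, then the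
  corner of the relator is passed from its second to its first letter.
\<close>

definition corner :: "('d, 'r) diagram \<Rightarrow> 'd \<Rightarrow> ('r \<times> nat) oedge" where
  "corner C d = (let b = opp C d in
     if ori C b then ((cell C b, pos C b), True) else ((cell C b, pos C (nxt C b)), False))"

text \<open>
  A dart that reads \<open>(a, \<epsilon>)\<close> starts at that end of the edge \<open>a\<close> which is the vertex \<open>(a, \<epsilon>)\<close> of
  the Whitehead graph. Hence the corners of consecutive darts at a vertex of the diagram meet in the letter of
  the dart between them, and inverse consecutive corners belong to 2-cells that are mirror images across this dart.
\<close>

lemma corner_props:
  assumes C: "spherical_diagram Q C" and z: "z \<in> darts C"
  defines "u \<equiv> (nxt C \<circ> opp C) z"
  shows "fst (corner C z) \<in> arcs (whitehead_graph Q)"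
    and "ostart (whitehead_graph Q) (corner C z) = dart_letter Q C z"
    and "oend (whitehead_graph Q) (corner C z) = dart_letter Q C u"
    and "corner C u = oinv (corner C z) \<Longrightarrow> folding_edge C u"
proof -
  have "sphere_cell_structure C" using C by (simp add: spherical_diagram_def)
  then interpret combinatorial_map "darts C" "opp C" "nxt C" by (simp add: sphere_cell_structure_iff)
  have all: "cell C d \<in> rels Q \<and> pos C d < length (relator Q (cell C d)) \<and>
          cell C (nxt C d) = cell C d \<and> ori C (nxt C d) = ori C d \<and>
          pos C (nxt C d) = (if ori C d then pos C d + 1 else pos C d + length (relator Q (cell C d)) - 1)
            mod length (relator Q (cell C d)) \<and>
          dart_letter Q C (opp C d) = oinv (dart_letter Q C d)" if "d \<in> darts C" for d
    using C that unfolding spherical_diagram_def Let_def by blast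
  define b where "b = opp C z"
  define n where "n = length (relator Q (cell C b))"
  have b: "b \<in> darts C" and ub: "u = nxt C b" using z by (simp_all add: b_def u_def)
  have u: "u \<in> darts C" using b ub by simp
  have n: "pos C b < n" "cell C b \<in> rels Q" "cell C u = cell C b" "ori C u = ori C b"
    using all[OF b] by (simp_all add: n_def ub)
  have pu: "pos C u = (if ori C b then pos C b + 1 else pos C b + n - 1) mod n"
    using all[OF b] by (simp add: n_def ub)
  have pu_less: "pos C u < n" using n(1) pu by simp
  have pb: "Suc (pos C u) mod n = pos C b" if "\<not> ori C b"
  proof -
    have "Suc (pos C u) mod n = (pos C b + n) mod n"
      using that n(1) unfolding pu by (simp add: mod_Suc_eq)
    then show ?thesis using n(1) by simp
  qed
  have lz: "dart_letter Q C z = oinv (dart_letter Q C b)"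
    using all[OF z] by (simp add: b_def)
  have corner: "corner C z = (if ori C b then ((cell C b, pos C b), True) else ((cell C b, pos C u), False))"
    by (simp add: corner_def b_def[symmetric] ub Let_def)
  show "fst (corner C z) \<in> arcs (whitehead_graph Q)"
    using n pu_less by (simp add: corner whitehead_graph_def n_def)
  show "ostart (whitehead_graph Q) (corner C z) = dart_letter Q C z"
    using pb unfolding lz
    by (auto simp: corner ostart_def whitehead_graph_def dart_letter_def oinv_def n_def split: prod.splits)
  show "oend (whitehead_graph Q) (corner C z) = dart_letter Q C u"
    using pu n
    by (auto simp: corner oend_def whitehead_graph_def dart_letter_def oinv_def n_def split: prod.splits)
  show "folding_edge C u" if rev: "corner C u = oinv (corner C z)"
  proof -
    define b' where "b' = opp C u"
    have b': "b' \<in> darts C" using u by (simp add: b'_def)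
    have cu: "corner C u = (if ori C b' then ((cell C b', pos C b'), True)
        else ((cell C b', pos C (nxt C b')), False))"
      by (simp add: corner_def b'_def[symmetric] Let_def)
    have ori: "ori C b' = (\<not> ori C b)" and cell: "cell C b' = cell C b"
      using rev by (auto simp: cu corner oinv_def split: if_splits)
    have n': "length (relator Q (cell C b')) = n" by (simp add: cell n_def)
    have "pos C b' = pos C u"
    proof (cases "ori C b")
      case True
      then have "pos C b = pos C (nxt C b')" using rev ori by (simp add: cu corner oinv_def)
      also have "\<dots> = (pos C b' + n - 1) mod n" using all[OF b'] n' ori True by simp
      finally have eq: "pos C b = (pos C b' + n - 1) mod n" .
      have "pos C b' < n" using all[OF b'] n' by simp
      then have "(pos C b + 1) mod n = pos C b'"
        unfolding eq using n(1) by (simp add: mod_Suc_eq)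
      then show ?thesis using pu True by simp
    next
      case False
      then show ?thesis using rev ori by (simp add: cu corner oinv_def)
    qed
    then show ?thesis using n cell ori by (simp add: folding_edge_def b'_def)
  qed
qed

text \<open>
  If all folding edges at a vertex carry the same letter, the link of the vertex backtracks at no other
  vertex of the Whitehead graph than this letter.
\<close>

lemma vertex_link:
  assumes C: "spherical_diagram Q C" and d: "d \<in> darts C"
    and fold: "\<And>z. z \<in> orbit (nxt C \<circ> opp C) d \<Longrightarrow> folding_edge C z \<Longrightarrow> dart_letter Q C z = w"
  shows "\<exists>c. reduced_cycle (whitehead_graph Q) c \<and> length c \<le> card (orbit (nxt C \<circ> opp C) d) \<and>
    set c \<subseteq> corner C ` orbit (nxt C \<circ> opp C) d"
proof -
  have "sphere_cell_structure C" using C by (simp add: spherical_diagram_def)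
  then interpret combinatorial_map "darts C" "opp C" "nxt C" by (simp add: sphere_cell_structure_iff)
  let ?v = "nxt C \<circ> opp C"
  let ?O = "orbit ?v d"
  have per: "permutation ?v" using v_perm fin permutation_permutes by blast
  have inO: "(?v ^^ j) d \<in> ?O" for j
    by (rule funpow_in_orbit[OF permutation_self_in_orbit[OF per]])
  have inD: "z \<in> darts C" if "z \<in> ?O" for z using permutes_orbit_subset[OF v_perm d] that by blast
  define n where "n = card ?O"
  have finO: "finite ?O" using finite_orbit[OF permutation_self_in_orbit[OF per]] .
  have pos: "0 < n" using finO orbit_nonempty[of ?v d] by (simp add: n_def card_gt_0_iff)
  have ret: "(?v ^^ n) d = d"
    unfolding n_def by (rule permutes_orbit_card_return[OF v_perm fin])
  define g where "g j = corner C ((?v ^^ j) d)" for j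
  have "\<exists>c. reduced_cycle (whitehead_graph Q) c \<and> length c \<le> n \<and> set c \<subseteq> range g"
  proof (rule closed_path_backtracking_at_one_vertex[OF pos])
    show "g (j + n) = g j" for j
      using ret by (simp add: g_def funpow_add)
    fix j
    note props = corner_props[OF C inD[OF inO[of j]]]
    have Suc: "?v ((?v ^^ j) d) = (?v ^^ Suc j) d" by simp
    show "fst (g j) \<in> arcs (whitehead_graph Q)" using props(1) by (simp add: g_def)
    show "oend (whitehead_graph Q) (g j) = ostart (whitehead_graph Q) (g (Suc j))"
      using props(3) corner_props(2)[OF C inD[OF inO[of "Suc j"]]] unfolding Suc g_def by simp
    show "oend (whitehead_graph Q) (g j) = w" if "g (Suc j) = oinv (g j)"
      using props(3,4) fold[OF inO[of "Suc j"]] that unfolding Suc g_def by simp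
  qed
  moreover have "range g \<subseteq> corner C ` ?O" using inO by (auto simp: g_def)
  ultimately show ?thesis unfolding n_def by blast
qed

section \<open>The two criteria on the Whitehead graph\<close>

text \<open>
  For \<open>s = True\<close> the diagram has a source, for \<open>s = False\<close> it has a sink. The link of this vertex lies in the part
  of the Whitehead graph of sign \<open>s\<close>, where \<open>(y, s)\<close> is the only vertex that belongs to the generator \<open>y\<close>.
\<close>

lemma folding_edge_of_sign_forest:
  fixes L :: "('v, 'e) labeled_graph"
  defines "Q \<equiv> LOT_presentation L"
  assumes C: "spherical_diagram Q C"
    and gens: "\<And>r. r \<in> rels Q \<Longrightarrow> fst ` set (relator Q r) \<subseteq> gens Q"
    and forest: "\<nexists>p. reduced_cycle (whitehead_graph Q \<restriction> (gens Q \<times> {s})) p"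
  shows "\<exists>d\<in>darts C. folding_edge C d \<and> edge_label Q C d \<noteq> y"
proof (rule ccontr)
  assume none: "\<not> ?thesis"
  have len: "length (relator Q r) = 4" for r by (simp add: Q_def relator_LOT_presentation)
  note sd = spherical_diagram_length4[OF C _ len]
  have "sphere_cell_structure C" using C by (simp add: spherical_diagram_def)
  then have ac: "combinatorial_map.mod2_acyclic (darts C) (opp C) (nxt C)" and ne: "darts C \<noteq> {}"
    and cm: "combinatorial_map (darts C) (opp C) (nxt C)"
    by (auto simp: sphere_cell_structure_iff)
  interpret combinatorial_map "darts C" "opp C" "nxt C" by (rule cm)
  let ?v = "nxt C \<circ> opp C"
  let ?W = "whitehead_graph Q"
  define sg where "sg d = snd (dart_letter Q C d)" for d
  have sg: "sg d \<longleftrightarrow> (pos C d < 2) = ori C d" if "d \<in> darts C" for d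
    unfolding sg_def Q_def by (rule snd_dart_letter_LOT_presentation[OF sd(2)[OF that]])
  have sg_opposite: "sg (nxt C (nxt C d)) = (\<not> sg d)" if d: "d \<in> darts C" for d
    using less_4_cases[OF sd(2)[OF d]] sg[OF d] sg[of "nxt C (nxt C d)"] d sd(4,5)[OF d]
      sd(4,5)[of "nxt C d"] by (cases "ori C d") auto
  have "\<exists>d\<in>darts C. \<forall>x\<in>orbit ?v d. sg x = s"
  proof (rule exists_vertex_of_constant_sign[OF ac ne])
    show "sg (opp C d) = (\<not> sg d)" if "d \<in> darts C" for d
      using sd(7)[OF that] by (simp add: sg_def oinv_def)
    fix d assume d: "d \<in> darts C"
    let ?\<sigma> = "\<lambda>x. if sg x then 1 else - 1 :: int"
    \<comment> \<open>Opposite sides of a 2-cell have opposite signs, so the exponent sum equals its negative.\<close>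
    have "(\<Sum>x\<in>orbit (nxt C) d. ?\<sigma> x) = (\<Sum>x\<in>orbit (nxt C) d. ?\<sigma> (nxt C (nxt C x)))"
      using sum_orbit_shift[OF f_perm fin, of ?\<sigma> d]
        sum_orbit_shift[OF f_perm fin, of "\<lambda>x. ?\<sigma> (nxt C x)" d] by simp
    also have "\<dots> = (\<Sum>x\<in>orbit (nxt C) d. - ?\<sigma> x)"
    proof (rule sum.cong[OF refl])
      fix x assume "x \<in> orbit (nxt C) d"
      then have "x \<in> darts C" using face_subset[OF d] by blast
      then show "?\<sigma> (nxt C (nxt C x)) = - ?\<sigma> x" using sg_opposite by simp
    qed
    finally show "(\<Sum>x\<in>orbit (nxt C) d. ?\<sigma> x) = 0" by (simp add: sum_negf)
  qed
  then obtain d where d: "d \<in> darts C" and sgs: "\<And>x. x \<in> orbit ?v d \<Longrightarrow> sg x = s" by blast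
  have inD: "x \<in> darts C" if "x \<in> orbit ?v d" for x using permutes_orbit_subset[OF v_perm d] that by blast
  have "\<exists>c. reduced_cycle ?W c \<and> length c \<le> card (orbit ?v d) \<and> set c \<subseteq> corner C ` orbit ?v d"
  proof (rule vertex_link[OF C d])
    fix z assume z: "z \<in> orbit ?v d" "folding_edge C z"
    then have "edge_label Q C z = y" using none inD by blast
    then show "dart_letter Q C z = (y, s)"
      using sgs[OF z(1)] by (simp add: edge_label_def sg_def prod_eq_iff)
  qed
  then obtain c where c: "reduced_cycle ?W c" "set c \<subseteq> corner C ` orbit ?v d" by blast
  let ?Ws = "?W \<restriction> (gens Q \<times> {s})"
  have letter_in: "dart_letter Q C x \<in> gens Q \<times> {s}" if x: "x \<in> orbit ?v d" for x
  proof -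
    have "relator Q (cell C x) ! pos C x \<in> set (relator Q (cell C x))"
      using sd(2)[OF inD[OF x]] len by simp
    then have "fst (dart_letter Q C x) \<in> fst ` set (relator Q (cell C x))"
      by (force simp: dart_letter_def split: prod.splits)
    then have "fst (dart_letter Q C x) \<in> gens Q" using gens[OF sd(1)[OF inD[OF x]]] by blast
    then show ?thesis using sgs[OF x] by (simp add: sg_def mem_Times_iff)
  qed
  have arcs_in: "fst k \<in> arcs ?Ws" if k: "k \<in> set c" for k
  proof -
    obtain x where x: "x \<in> orbit ?v d" "k = corner C x" using c(2) k by blast
    have vx: "?v x \<in> orbit ?v d" using x(1) by (rule orbit.step)
    note props = corner_props[OF C inD[OF x(1)]]
    have "ostart ?W k \<in> gens Q \<times> {s}" "oend ?W k \<in> gens Q \<times> {s}"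
      using props(2,3) letter_in[OF x(1)] letter_in[OF vx] x(2) by simp_all
    then show ?thesis
      using props(1) x(2) unfolding induce_subgraph_def ostart_def oend_def
      by (auto split: if_splits)
  qed
  have "ostart ?Ws k = ostart ?W k" "oend ?Ws k = oend ?W k" for k
    by (simp_all add: ostart_def oend_def induce_subgraph_def)
  then have "reduced_cycle ?Ws c"
    using c(1) arcs_in unfolding reduced_cycle_def closed_edge_path_def by auto
  then show False using forest by blast
qed

lemma edge_label_next_neq:
  fixes L :: "('v, 'e) labeled_graph"
  defines "Q \<equiv> LOT_presentation L"
  assumes C: "spherical_diagram Q C" and comp: "compressed Q" and b: "b \<in> darts C"
  shows "edge_label Q C (nxt C b) \<noteq> edge_label Q C b"
proof -
  have len: "length (relator Q r) = 4" for r by (simp add: Q_def relator_LOT_presentation)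
  note sd = spherical_diagram_length4[OF C b len]
  let ?r = "cell C b"
  have "card {tail (lgraph L) ?r, elabel L ?r, head (lgraph L) ?r} = 3"
    using comp sd(1) unfolding compressed_def Q_def by (simp add: relator_LOT_presentation insert_commute)
  then have "tail (lgraph L) ?r \<noteq> elabel L ?r" "elabel L ?r \<noteq> head (lgraph L) ?r"
    by (auto simp: card_insert_if split: if_splits)
  then show ?thesis
    using less_4_cases[OF sd(2)] sd(3,4,5)
    by (cases "ori C b") (auto simp: edge_label_def dart_letter_def Q_def relator_LOT_presentation)
qed

text \<open>
  From \<open>V - E + F = 2\<close> and \<open>2 * E = 4 * F\<close>, the sum of all vertex degrees is \<open>2 * E = 4 * V - 8\<close>.
\<close>

lemma exists_vertex_of_degree_less_4:
  assumes C: "sphere_cell_structure C" and faces: "\<And>d. d \<in> darts C \<Longrightarrow> card (orbit (nxt C) d) = 4"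
  shows "\<exists>d\<in>darts C. card (orbit (nxt C \<circ> opp C) d) < 4"
proof (rule ccontr)
  assume none: "\<not> ?thesis"
  have cm: "combinatorial_map (darts C) (opp C) (nxt C)"
    using C by (simp add: sphere_cell_structure_iff)
  interpret combinatorial_map "darts C" "opp C" "nxt C" by (rule cm)
  let ?v = "nxt C \<circ> opp C"
  have euler: "card (orbit ?v ` darts C) + card (orbit (nxt C) ` darts C) = card (orbit (opp C) ` darts C) + 2"
    using C euler_char_2_iff_mod2_acyclic by (simp add: sphere_cell_structure_iff)
  have "card (darts C) = (\<Sum>F\<in>orbit (nxt C) ` darts C. card F)"
    using sum_over_orbits[OF f_perm fin, of "\<lambda>_. 1::nat"] by simp
  also have "\<dots> = (\<Sum>F\<in>orbit (nxt C) ` darts C. 4)"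
    by (rule sum.cong) (use faces in auto)
  also have "\<dots> = 4 * card (orbit (nxt C) ` darts C)" by simp
  finally have F: "card (darts C) = 4 * card (orbit (nxt C) ` darts C)" .
  have "4 * card (orbit ?v ` darts C) = (\<Sum>B\<in>orbit ?v ` darts C. 4)" by simp
  also have "\<dots> \<le> (\<Sum>B\<in>orbit ?v ` darts C. card B)"
  proof (rule sum_mono)
    fix B assume "B \<in> orbit ?v ` darts C"
    then obtain d where "d \<in> darts C" "B = orbit ?v d" by blast
    then show "4 \<le> card B" using none by (meson not_less)
  qed
  also have "\<dots> = card (darts C)"
    using sum_over_orbits[OF v_perm fin, of "\<lambda>_. 1::nat"] by simp
  finally show False using euler F card_darts by linarith
qed

text \<open>
  At a vertex of degree less than four at most one edge is labelled \<open>y\<close>, so if all folding edges are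
  labelled \<open>y\<close>, then backtracks of its link occur at a single vertex of the Whitehead graph.
\<close>

lemma folding_edge_of_girth_4:
  fixes L :: "('v, 'e) labeled_graph"
  defines "Q \<equiv> LOT_presentation L"
  assumes C: "spherical_diagram Q C" and comp: "compressed Q"
    and girth: "\<And>p. reduced_cycle (whitehead_graph Q) p \<Longrightarrow> \<not> length p < 4"
  shows "\<exists>d\<in>darts C. folding_edge C d \<and> edge_label Q C d \<noteq> y"
proof (rule ccontr)
  assume none: "\<not> ?thesis"
  have len: "length (relator Q r) = 4" for r by (simp add: Q_def relator_LOT_presentation)
  note sd = spherical_diagram_length4[OF C _ len]
  have sphere: "sphere_cell_structure C" using C by (simp add: spherical_diagram_def)
  then interpret combinatorial_map "darts C" "opp C" "nxt C" by (simp add: sphere_cell_structure_iff)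
  let ?v = "nxt C \<circ> opp C"
  obtain d where d: "d \<in> darts C" and deg: "card (orbit ?v d) < 4"
    using exists_vertex_of_degree_less_4[OF sphere sd(6)] by blast
  let ?O = "orbit ?v d"
  have inD: "x \<in> darts C" if "x \<in> ?O" for x using permutes_orbit_subset[OF v_perm d] that by blast
  have adj: "edge_label Q C (?v x) \<noteq> edge_label Q C x" if "x \<in> darts C" for x
  proof -
    have "edge_label Q C (opp C x) = edge_label Q C x"
      using sd(7)[OF that] by (simp add: edge_label_def oinv_def)
    then show ?thesis
      using edge_label_next_neq[of L C "opp C x"] C comp that by (simp add: Q_def)
  qed
  have unique: "z = x" if z: "z \<in> ?O" "x \<in> ?O" and lab: "edge_label Q C z = y" "edge_label Q C x = y" for z x
  proof -
    have O: "orbit ?v x = ?O" using z(2) permutes_orbit_eq_iff[OF v_perm fin] by blast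
    define n where "n = card ?O"
    have ret: "(?v ^^ n) x = x"
      using permutes_orbit_card_return[OF v_perm fin, of x] unfolding O n_def .
    have "finite ?O" using finite_subset[OF permutes_orbit_subset[OF v_perm d] fin] .
    then have "0 < n" using orbit_nonempty[of ?v d] by (simp add: n_def card_gt_0_iff)
    then obtain k where k: "k < n" "z = (?v ^^ k) x"
      using orbit_altdef_bounded[OF ret] z(1) O by auto
    have "n < 4" using deg by (simp add: n_def)
    then have "k = 0 \<or> k = 1 \<or> k = 2 \<and> n = 3" using k(1) by linarith
    then show "z = x"
    proof (elim disjE conjE)
      assume "k = 0"
      then show ?thesis using k by simp
    next
      assume "k = 1"
      then have "z = ?v x" using k by simp
      then show ?thesis using adj[OF inD[OF z(2)]] lab by simp
    next
      assume "k = 2" "n = 3"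
      then have "?v z = x" using ret k by (simp add: numeral_eq_Suc)
      then show ?thesis using adj[OF inD[OF z(1)]] lab by simp
    qed
  qed
  \<comment> \<open>If no edge at the vertex is labelled \<open>y\<close>, then there are no backtracks and any \<open>w\<close> will do.\<close>
  define w where "w = dart_letter Q C (SOME x. x \<in> ?O \<and> edge_label Q C x = y)"
  have "\<exists>c. reduced_cycle (whitehead_graph Q) c \<and> length c \<le> card ?O \<and> set c \<subseteq> corner C ` ?O"
  proof (rule vertex_link[OF C d])
    fix z assume z: "z \<in> ?O" "folding_edge C z"
    then have lab: "z \<in> ?O \<and> edge_label Q C z = y" using none inD by blast
    then have "(SOME x. x \<in> ?O \<and> edge_label Q C x = y) = z"
      using unique someI[of "\<lambda>x. x \<in> ?O \<and> edge_label Q C x = y" z] by blast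
    then show "dart_letter Q C z = w" by (simp add: w_def)
  qed
  then show False using girth deg by fastforce
qed

text \<open>
  If the sub-LOT has all edges, then it lacks a vertex. Otherwise a remaining relator
  involves three generators.
\<close>

lemma collapse_has_other_generator:
  fixes LP LT :: "('v, 'e) labeled_graph" and y :: 'v
  defines "Pbar \<equiv> LOT_presentation (collapse LP LT y)"
  assumes LOT: "LOT LP" and sub: "sub_LOT LT LP" and neq: "LT \<noteq> LP"
    and y: "y \<notin> verts (lgraph LP) - verts (lgraph LT)"
    and comp: "compressed Pbar"
  shows "{y} \<subset> gens Pbar"
proof -
  have sg: "subgraph (lgraph LT) (lgraph LP)" and el: "elabel LT = elabel LP"
    and ne: "arcs (lgraph LT) \<noteq> {}" using sub by (auto simp: sub_LOT_def)
  have VS: "verts (lgraph LT) \<subseteq> verts (lgraph LP)" "arcs (lgraph LT) \<subseteq> arcs (lgraph LP)"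
    and wf: "wf_digraph (lgraph LT)"
    and th: "tail (lgraph LP) = tail (lgraph LT)" "head (lgraph LP) = head (lgraph LT)"
    using sg by (auto simp: subgraph_def compatible_def)
  have gens: "gens Pbar = collapse_map LT y ` verts (lgraph LP)" by (simp add: Pbar_def collapse_sel)
  obtain a where "a \<in> arcs (lgraph LT)" using ne by blast
  then have "tail (lgraph LT) a \<in> verts (lgraph LT)" using wf by (simp add: wf_digraph_def)
  then have "y \<in> gens Pbar" using VS(1) unfolding gens by (force simp: collapse_map_def)
  moreover have "gens Pbar \<noteq> {y}"
  proof (cases "arcs (lgraph LP) = arcs (lgraph LT)")
    case True
    have "verts (lgraph LT) \<noteq> verts (lgraph LP)"
    proof
      assume "verts (lgraph LT) = verts (lgraph LP)"
      then have "lgraph LT = lgraph LP" using True th by (intro pre_digraph.equality) simp_all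
      then have "LT = LP" using el by (intro labeled_graph.equality) simp_all
      then show False using neq by contradiction
    qed
    then obtain x where x: "x \<in> verts (lgraph LP)" "x \<notin> verts (lgraph LT)" using VS(1) by blast
    then have "x \<in> gens Pbar" unfolding gens by (force simp: collapse_map_def)
    moreover have "x \<noteq> y" using x y by blast
    ultimately show ?thesis by blast
  next
    case False
    then obtain r where r: "r \<in> rels Pbar" using VS(2) by (auto simp: Pbar_def collapse_sel)
    have "fst ` set (relator Pbar r) \<subseteq> gens Pbar"
      unfolding Pbar_def by (rule collapse_relator_gens[OF LOT]) (use r in \<open>simp add: Pbar_def\<close>)
    moreover have "card (fst ` set (relator Pbar r)) = 3" using comp r by (simp add: compressed_def)
    ultimately show ?thesis
      by (metis One_nat_def card_mono card.empty card_insert_disjoint empty_iff finite.intros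
          numeral_3_eq_3 not_less_eq_eq le0 Suc_le_mono)
  qed
  ultimately show ?thesis by blast
qed

lemma collapse_DR_by_whitehead_graph:
  fixes LP LT :: "('v, 'e) labeled_graph" and y :: 'v
  defines "Pbar \<equiv> LOT_presentation (collapse LP LT y)"
  assumes LOT: "LOT LP" and sub: "sub_LOT LT LP" and neq: "LT \<noteq> LP"
    and y: "y \<notin> verts (lgraph LP) - verts (lgraph LT)"
    and comp: "compressed Pbar"
    and crit: "(undirected_tree (whitehead_plus Pbar) \<or> undirected_tree (whitehead_minus Pbar)) \<or>
        (\<forall>p. reduced_cycle (whitehead_graph Pbar) p \<longrightarrow> \<not> length p < 4)"
  shows "DR_directed_away_from Pbar {y}"
proof -
  have "\<exists>d\<in>darts C. folding_edge C d \<and> edge_label Pbar C d \<notin> {y}"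
    if C: "spherical_diagram Pbar C" for C :: "(nat, 'e) diagram"
  proof -
    note forest = folding_edge_of_sign_forest[OF C[unfolded Pbar_def] collapse_relator_gens[OF LOT],
      folded Pbar_def]
    from crit consider
        "\<nexists>p. reduced_cycle (whitehead_graph Pbar \<restriction> (gens Pbar \<times> {True})) p"
      | "\<nexists>p. reduced_cycle (whitehead_graph Pbar \<restriction> (gens Pbar \<times> {False})) p"
      | "\<And>p. reduced_cycle (whitehead_graph Pbar) p \<Longrightarrow> \<not> length p < 4"
      unfolding undirected_tree_def whitehead_plus_def whitehead_minus_def by blast
    then show ?thesis
    proof cases
      case 1
      then show ?thesis using forest[of True y] by simp
    next
      case 2
      then show ?thesis using forest[of False y] by simp
    next
      case 3
      then show ?thesis
        using folding_edge_of_girth_4[OF C[unfolded Pbar_def] comp[unfolded Pbar_def], of y]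
        by (simp add: Pbar_def)
    qed
  qed
  moreover have "{y} \<subset> gens Pbar"
    unfolding Pbar_def by (rule collapse_has_other_generator[OF LOT sub neq y comp[unfolded Pbar_def]])
  ultimately show ?thesis unfolding DR_directed_away_from_def by blast
qed


section \<open>Directed diagrammatic reducibility of the LOT presentation\<close>

theorem theorem6p3:
  fixes LP LT LPbar :: "('v, 'e) labeled_graph"
    and P T Pbar :: "('v, 'e) presentation"
    and S :: "'v set" and y :: 'v
  assumes "LOT LP"
    and "maximal_proper_sub_LOT LT LP"
    and "y \<notin> verts (lgraph LP) - verts (lgraph LT)"
    and "LPbar = collapse LP LT y"
    and "P = LOT_presentation LP"
    and "T = LOT_presentation LT"
    and "Pbar = LOT_presentation LPbar"
    and "S = gens T"
    and "compressed P"
  shows "(compressed Pbar \<and> DR_directed_away_from Pbar {y} \<longrightarrow> DR_directed_away_from P S) \<and>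
    (compressed Pbar \<and>
       ((undirected_tree (whitehead_plus Pbar) \<or> undirected_tree (whitehead_minus Pbar)) \<or>
        (\<forall>p. reduced_cycle (whitehead_graph Pbar) p \<longrightarrow> \<not> length p < 4))
     \<longrightarrow> DR_directed_away_from P S)"
proof -
  have sub: "sub_LOT LT LP" "LT \<noteq> LP"
    using assms(2) by (simp_all add: maximal_proper_sub_LOT_def)
  have lift: "DR_directed_away_from P S" if "DR_directed_away_from Pbar {y}"
    using DR_directed_away_from_collapse[OF assms(1) sub(1) assms(3)] that assms(4-8) by simp
  show ?thesis
    using lift collapse_DR_by_whitehead_graph[OF assms(1) sub assms(3), folded assms(4), folded assms(7)]
    by blast
qed

end
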